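(* Let $n\geq 3$, let $\mathbb B_n:=\mathbb Q(\cos(\pi/2^{n+1}))$, and let $RE_n^+:=\{\epsilon\in\mathcal O_{\mathbb B_n}^\times \mid \mathrm{N}_{\mathbb B_n/\mathbb B_{n-1}}(\epsilon)=1\}$. Then for every $\epsilon\in RE_n^+$ with $\epsilon\neq\pm1$ we have $$\mathrm{Tr}_{\mathbb B_n/\mathbb Q}(\epsilon^2)\geq 33\cdot 2^n .$$ Equivalently, $\min\{\mathrm{Tr}\,\epsilon^2 \mid \pm1\neq \epsilon\in RE_n^+\}\geq 2^n\cdot 33$.
   Context: $\mathbb B_n$ is the $n$th layer of the cyclotomic $\mathbb Z_2$-extension of $\mathbb Q$ (a totally real cyclic field of degree $2^n$), and $\mathbb B_{n-1}\subset \mathbb B_n$ is its subfield of index $2$. $\mathrm{N}_{\mathbb B_n/\mathbb B_{n-1}}$ denotes the relative norm and $\mathrm{Tr}$ the absolute trace $\mathrm{Tr}_{\mathbb B_n/\mathbb Q}$. *)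

theory Defs
  imports
    Complex_Main
    "HOL-Computational_Algebra.Polynomial"
    "HOL-Algebra.Generated_Fields"
    "HOL-Algebra.Embedded_Algebras"
    "HOL-Algebra.Algebraic_Closure_Type"
    "Jordan_Normal_Form.Determinant"
begin

text \<open>All fields below are subfields of the field of real numbers, which is
  viewed as a HOL-Algebra ring so that its subfields, the fields generated by a set, and
  linear algebra over a subfield are available.\<close>

abbreviation real_ring :: "real ring" where
  "real_ring \<equiv> ring_of_type_algebra"

definition field_basis :: "real set \<Rightarrow> real set \<Rightarrow> real list \<Rightarrow> bool" where
  "field_basis K L us \<longleftrightarrow>
     ring.independent real_ring K us \<and> ring.Span real_ring K us = L"

text \<open>The matrix (with entries in \<open>K\<close>) of multiplication by \<open>x\<close> with respect to the
  \<open>K\<close>-basis \<open>us\<close>: column \<open>j\<close> holds the coordinates of \<open>x * us ! j\<close>.\<close>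

definition is_mult_matrix :: "real set \<Rightarrow> real list \<Rightarrow> real \<Rightarrow> real mat \<Rightarrow> bool" where
  "is_mult_matrix K us x A \<longleftrightarrow>
     A \<in> carrier_mat (length us) (length us) \<and>
     (\<forall>i < length us. \<forall>j < length us. A $$ (i, j) \<in> K) \<and>
     (\<forall>j < length us. x * us ! j = (\<Sum>i < length us. A $$ (i, j) * us ! i))"

text \<open>Norm and trace of a finite extension \<open>L\<close> of \<open>K\<close>: determinant and trace of the
  \<open>K\<close>-linear map \<open>y \<mapsto> x * y\<close> on \<open>L\<close>. They do not depend on the basis, so the
  definite descriptions are well-defined for \<open>x \<in> L\<close>.\<close>

definition field_norm :: "real set \<Rightarrow> real set \<Rightarrow> real \<Rightarrow> real" where
  "field_norm L K x =
     (THE d. \<exists>us A. field_basis K L us \<and> is_mult_matrix K us x A \<and> d = det A)"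

definition field_trace :: "real set \<Rightarrow> real set \<Rightarrow> real \<Rightarrow> real" where
  "field_trace L K x =
     (THE t. \<exists>us A. field_basis K L us \<and> is_mult_matrix K us x A \<and>
        t = (\<Sum>i < length us. A $$ (i, i)))"

definition ring_of_integers :: "real set \<Rightarrow> real set" where
  "ring_of_integers L = {x \<in> L. algebraic_int x}"

definition integer_units :: "real set \<Rightarrow> real set" where
  "integer_units L = Units (real_ring\<lparr>carrier := ring_of_integers L\<rparr>)"

definition B_field :: "nat \<Rightarrow> real set" where
  "B_field n = generate_field real_ring (insert (cos (pi / 2 ^ (n + 1))) \<rat>)"

text \<open>Only meaningful for \<open>n \<ge> 1\<close>, since \<open>n - 1\<close> is truncated subtraction.\<close>

definition RE_plus :: "nat \<Rightarrow> real set" where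
  "RE_plus n = {\<epsilon> \<in> integer_units (B_field n).
     field_norm (B_field n) (B_field (n - 1)) \<epsilon> = 1}"

end

theory Submission
  imports Defs "Jordan_Normal_Form.Char_Poly"
begin

text \<open>Write \<open>N = 2 ^ n\<close> and \<open>b k = 2 cos (k \<pi> / 2 ^ (n + 1))\<close>. The numbers \<open>1, b 1, \<dots>, b (N - 1)\<close>
  form an integral basis of \<open>B_field n\<close>, orthogonal for the trace form, so that an integer
  \<open>a\<^sub>0 + (\<Sum>k. a\<^sub>k b k)\<close> satisfies \<open>Tr (\<epsilon>\<^sup>2) = N (a\<^sub>0\<^sup>2 + 2 (\<Sum>k. a\<^sub>k\<^sup>2))\<close>. Split \<open>\<epsilon> = x + y\<close> into the
  parts with even and with odd indices; the nontrivial automorphism over \<open>B_field (n - 1)\<close> maps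
  \<open>\<epsilon>\<close> to \<open>x - y\<close>, so the relative norm condition reads \<open>x\<^sup>2 - y\<^sup>2 = 1\<close>, whence
  \<open>Tr (\<epsilon>\<^sup>2) = N + 2 Tr (y\<^sup>2)\<close>. Since 2 is totally ramified, comparing valuations in
  \<open>(x - 1) * (x + 1) = y\<^sup>2\<close> shows that 2 divides \<open>x - 1\<close> and \<open>y\<close>. Hence \<open>Tr (y\<^sup>2) = 8 N D\<close>, where
  \<open>D\<close> is a sum of squares of integers, and the claim is \<open>D \<ge> 2\<close>. The case \<open>D = 0\<close> is \<open>\<epsilon> = \<plusminus> 1\<close>.
  If \<open>D = 1\<close>, then \<open>y = \<plusminus> 2 b r\<close> and \<open>x\<^sup>2 = 9 + 4 b (2 r)\<close> with \<open>r\<close> odd; the trace of \<open>x\<^sup>2\<close> leaves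
  only \<open>x = \<plusminus> 3\<close> and \<open>x = \<plusminus> 1 \<plusminus> 2 b k\<close> with \<open>k\<close> even, and the conjugation with \<open>m = N + 1\<close>
  excludes both when \<open>n \<ge> 3\<close>.\<close>

section \<open>Algebraic integers\<close>

text \<open>Multiplication by \<open>z\<close> on the \<open>v k\<close> is an integer matrix with
  eigenvector \<open>v\<close> and eigenvalue \<open>z\<close>, so \<open>z\<close> is a root of its
  monic integral characteristic polynomial; \<open>v i \<noteq> 0\<close> keeps the eigenvector from
  vanishing.\<close>

lemma algebraic_int_if_stable_span:
  fixes v :: "nat \<Rightarrow> real"
  assumes "i < r" "v i \<noteq> 0"
    and stable: "\<And>k. k < r \<Longrightarrow> \<exists>c :: nat \<Rightarrow> int. z * v k = (\<Sum>j<r. of_int (c j) * v j)"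
  shows "algebraic_int z"
proof -
  obtain C :: "nat \<Rightarrow> nat \<Rightarrow> int"
    where C: "\<And>k. k < r \<Longrightarrow> z * v k = (\<Sum>j<r. of_int (C k j) * v j)"
    using stable by metis
  define A where "A = mat r r (\<lambda>(k, j). C k j)"
  have A: "A \<in> carrier_mat r r" by (simp add: A_def)
  hence A': "map_mat real_of_int A \<in> carrier_mat r r" by simp
  have "eigenvector (map_mat real_of_int A) (vec r v) z"
    unfolding eigenvector_def
  proof (intro conjI)
    show "vec r v \<noteq> 0\<^sub>v (dim_row (map_mat real_of_int A))"
      using assms(1,2) A by (metis carrier_matD(1) index_vec index_zero_vec(1) map_carrier_mat)
    show "map_mat real_of_int A *\<^sub>v vec r v = z \<cdot>\<^sub>v vec r v"
      by (rule eq_vecI) (auto simp: A_def scalar_prod_def C lessThan_atLeast0)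
  qed (use A in auto)
  hence "poly (char_poly (map_mat real_of_int A)) z = 0"
    using eigenvalue_root_char_poly[OF A'] by (auto simp: eigenvalue_def)
  moreover have "Polynomial.lead_coeff (char_poly A) = 1"
    using degree_monic_char_poly[OF A] by simp
  ultimately show ?thesis
    unfolding algebraic_int_altdef_ipoly using of_int_hom.char_poly_hom[OF A, where 'a=real] by metis
qed

lemma algebraic_int_power_reduce:
  fixes a :: real
  assumes "algebraic_int a"
  obtains d :: nat and c :: "nat \<Rightarrow> int"
  where "d > 0" "a ^ d = (\<Sum>i<d. of_int (c i) * a ^ i)"
proof -
  obtain p where p: "poly (map_poly of_int p) a = 0" "Polynomial.lead_coeff p = 1"
    using assms unfolding algebraic_int_altdef_ipoly by blast
  define d where "d = Polynomial.degree p"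
  have "d \<noteq> 0"
  proof
    assume "d = 0"
    then obtain e where "p = [:e:]" unfolding d_def by (auto elim: degree_eq_zeroE)
    with p show False by simp
  qed
  have "0 = (\<Sum>i\<le>d. of_int (Polynomial.coeff p i) * a ^ i)"
    using p(1) by (simp add: poly_altdef degree_map_poly coeff_map_poly d_def)
  also have "\<dots> = (\<Sum>i<d. of_int (Polynomial.coeff p i) * a ^ i) + a ^ d"
    using p(2) by (simp add: d_def flip: lessThan_Suc_atMost)
  finally have "a ^ d = (\<Sum>i<d. of_int (- Polynomial.coeff p i) * a ^ i)"
    by (simp add: sum_negf)
  with \<open>d \<noteq> 0\<close> show thesis using that[of d "\<lambda>i. - Polynomial.coeff p i"] by simp
qed

section \<open>Finitely generated modules over the integers; sums and products of algebraic
  integers\<close>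

definition int_span :: "nat \<Rightarrow> (nat \<Rightarrow> real) \<Rightarrow> real set" where
  "int_span r v = {\<Sum>k<r. of_int (c k) * v k | c :: nat \<Rightarrow> int. True}"

lemma int_spanI: "(\<Sum>k<r. of_int (c k :: int) * v k) \<in> int_span r v"
  unfolding int_span_def by blast

lemma int_span_base: "k < r \<Longrightarrow> v k \<in> int_span r v"
  using int_spanI[where c="\<lambda>j. if j = k then 1 else 0" and r=r and v=v]
  by (simp add: if_distrib[of real_of_int] if_distrib[of "\<lambda>x. x * _"] cong: if_cong)

lemma int_span_add:
  assumes "x \<in> int_span r v" "y \<in> int_span r v"
  shows "x + y \<in> int_span r v"
proof -
  obtain c d where "x = (\<Sum>k<r. of_int (c k :: int) * v k)" "y = (\<Sum>k<r. of_int (d k :: int) * v k)"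
    using assms unfolding int_span_def by blast
  hence "x + y = (\<Sum>k<r. of_int (c k + d k) * v k)"
    by (simp add: sum.distrib distrib_right)
  thus ?thesis by (metis int_spanI)
qed

lemma int_span_scale:
  assumes "x \<in> int_span r v"
  shows "of_int a * x \<in> int_span r v"
proof -
  obtain c where "x = (\<Sum>k<r. of_int (c k :: int) * v k)"
    using assms unfolding int_span_def by blast
  hence "of_int a * x = (\<Sum>k<r. of_int (a * c k) * v k)"
    by (simp add: sum_distrib_left mult.assoc)
  thus ?thesis by (metis int_spanI)
qed

lemma int_span_sum:
  "(\<And>i. i \<in> I \<Longrightarrow> f i \<in> int_span r v) \<Longrightarrow> (\<Sum>i\<in>I. of_int (c i) * f i) \<in> int_span r v"
proof (induction I rule: infinite_finite_induct)
  case (insert i I)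
  thus ?case by (simp add: int_span_add int_span_scale)
qed (use int_spanI[where c="\<lambda>_. 0" and r=r and v=v] in auto)

lemma int_span_stable:
  assumes "\<And>k. k < r \<Longrightarrow> z * v k \<in> int_span r v" and "x \<in> int_span r v"
  shows "z * x \<in> int_span r v"
proof -
  obtain c where "x = (\<Sum>k<r. of_int (c k :: int) * v k)"
    using assms(2) unfolding int_span_def by blast
  hence "z * x = (\<Sum>k<r. of_int (c k) * (z * v k))"
    by (simp add: sum_distrib_left mult_ac)
  thus ?thesis using assms(1) by (auto intro: int_span_sum)
qed

lemma algebraic_int_if_int_span_stable:
  assumes "i < r" "v i \<noteq> 0" "\<And>k. k < r \<Longrightarrow> z * v k \<in> int_span r v"
  shows "algebraic_int z"
  by (rule algebraic_int_if_stable_span[of i r v]) (use assms in \<open>auto simp: int_span_def\<close>)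

text \<open>The monomials \<open>a ^ i * b ^ j\<close> with exponents below the degrees of monic
  relations for \<open>a\<close> and \<open>b\<close> span such a module: an exponent that reaches
  the degree is reduced by its relation. The span is then stable under \<open>a + b\<close> and
  \<open>a * b\<close> as well.\<close>

lemma algebraic_int_pair_module:
  fixes a b :: real
  assumes "algebraic_int a" "algebraic_int b"
  obtains r v where "(0::nat) < r" "v 0 = (1::real)"
    "\<And>x. x \<in> int_span r v \<Longrightarrow> a * x \<in> int_span r v"
    "\<And>x. x \<in> int_span r v \<Longrightarrow> b * x \<in> int_span r v"
proof -
  obtain d c where d: "d > 0" and c: "a ^ d = (\<Sum>i<d. of_int (c i :: int) * a ^ i)"
    using algebraic_int_power_reduce[OF assms(1)] by blast
  obtain e f where e: "e > 0" and f: "b ^ e = (\<Sum>i<e. of_int (f i :: int) * b ^ i)"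
    using algebraic_int_power_reduce[OF assms(2)] by blast
  \<comment> \<open>The pair \<open>(i, j)\<close> is stored at index \<open>i * e + j\<close> and
    recovered by \<open>div\<close> and \<open>mod\<close>.\<close>
  define v where "v k = a ^ (k div e) * b ^ (k mod e)" for k
  define S where "S = int_span (d * e) v"
  have mem: "a ^ i * b ^ j \<in> S" if "i < d" "j < e" for i j
  proof -
    have "i * e + j < Suc i * e" using that by simp
    also have "\<dots> \<le> d * e" using that by (intro mult_le_mono) auto
    finally have "i * e + j < d * e" .
    moreover have "v (i * e + j) = a ^ i * b ^ j" using that e by (simp add: v_def)
    ultimately show ?thesis unfolding S_def by (metis int_span_base)
  qed
  have stable_a: "a * v k \<in> S" if "k < d * e" for k
  proof -
    define i j where "i = k div e" and "j = k mod e"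
    have ij: "i < d" "j < e" using that e by (auto simp: i_def j_def less_mult_imp_div_less)
    have av: "a * v k = a ^ Suc i * b ^ j" by (simp add: v_def i_def j_def)
    show ?thesis
    proof (cases "Suc i < d")
      case True thus ?thesis using mem ij av by metis
    next
      case False
      hence "Suc i = d" using ij by simp
      hence "a * v k = (\<Sum>i<d. of_int (c i) * (a ^ i * b ^ j))"
        using av c by (simp add: sum_distrib_left mult_ac)
      thus ?thesis using mem ij unfolding S_def by (auto intro!: int_span_sum)
    qed
  qed
  have stable_b: "b * v k \<in> S" if "k < d * e" for k
  proof -
    define i j where "i = k div e" and "j = k mod e"
    have ij: "i < d" "j < e" using that e by (auto simp: i_def j_def less_mult_imp_div_less)
    have bv: "b * v k = a ^ i * b ^ Suc j" by (simp add: v_def i_def j_def)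
    show ?thesis
    proof (cases "Suc j < e")
      case True thus ?thesis using mem ij bv by metis
    next
      case False
      hence "Suc j = e" using ij by simp
      hence "b * v k = (\<Sum>j<e. of_int (f j) * (a ^ i * b ^ j))"
        using bv f by (simp add: sum_distrib_left mult_ac)
      thus ?thesis using mem ij unfolding S_def by (auto intro!: int_span_sum)
    qed
  qed
  show thesis
  proof (rule that[of "d * e" v])
    show "0 < d * e" using d e by simp
    show "v 0 = 1" by (simp add: v_def)
  qed (use stable_a stable_b int_span_stable S_def in blast)+
qed

lemma algebraic_int_add:
  fixes a b :: real
  assumes "algebraic_int a" "algebraic_int b"
  shows "algebraic_int (a + b)"
proof -
  obtain r v where rv: "(0::nat) < r" "v 0 = (1::real)"
    "\<And>x. x \<in> int_span r v \<Longrightarrow> a * x \<in> int_span r v"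
    "\<And>x. x \<in> int_span r v \<Longrightarrow> b * x \<in> int_span r v"
    using algebraic_int_pair_module[OF assms] by blast
  show ?thesis
    by (rule algebraic_int_if_int_span_stable[of 0 r v])
       (use rv in \<open>auto simp: distrib_right int_span_add int_span_base\<close>)
qed

lemma algebraic_int_mult:
  fixes a b :: real
  assumes "algebraic_int a" "algebraic_int b"
  shows "algebraic_int (a * b)"
proof -
  obtain r v where rv: "(0::nat) < r" "v 0 = (1::real)"
    "\<And>x. x \<in> int_span r v \<Longrightarrow> a * x \<in> int_span r v"
    "\<And>x. x \<in> int_span r v \<Longrightarrow> b * x \<in> int_span r v"
    using algebraic_int_pair_module[OF assms] by blast
  show ?thesis
    by (rule algebraic_int_if_int_span_stable[of 0 r v])
       (use rv in \<open>auto simp: mult.assoc int_span_base\<close>)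
qed

lemma algebraic_int_diff:
  "algebraic_int (a :: real) \<Longrightarrow> algebraic_int b \<Longrightarrow> algebraic_int (a - b)"
  using algebraic_int_add[of a "- b"] by simp

lemma algebraic_int_sum:
  "(\<And>i. i \<in> I \<Longrightarrow> algebraic_int (f i :: real)) \<Longrightarrow> algebraic_int (\<Sum>i\<in>I. f i)"
  by (induction I rule: infinite_finite_induct) (auto intro: algebraic_int_add)

lemma algebraic_int_power:
  "algebraic_int (a :: real) \<Longrightarrow> algebraic_int (a ^ k)"
  by (induction k) (auto intro: algebraic_int_mult)

section \<open>Linear algebra over subfields of the reals\<close>

text \<open>One predicate serves \<open>\<int>\<close>, \<open>\<rat>\<close>, the ring of real
  algebraic integers and the rings \<open>adjoin K t\<close>, so that the calculus of coefficients
  is developed once.\<close>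

definition is_real_subring :: "real set \<Rightarrow> bool" where
  "is_real_subring K \<longleftrightarrow> 1 \<in> K \<and> (\<forall>x\<in>K. \<forall>y\<in>K. x - y \<in> K \<and> x * y \<in> K)"

lemma is_real_subringD:
  assumes "is_real_subring K"
  shows "0 \<in> K" "1 \<in> K" "2 \<in> K" "x \<in> K \<Longrightarrow> - x \<in> K"
    "x \<in> K \<Longrightarrow> y \<in> K \<Longrightarrow> x + y \<in> K" "x \<in> K \<Longrightarrow> y \<in> K \<Longrightarrow> x - y \<in> K"
    "x \<in> K \<Longrightarrow> y \<in> K \<Longrightarrow> x * y \<in> K" "x \<in> K \<Longrightarrow> x ^ k \<in> K"
proof -
  show 1: "1 \<in> K" using assms by (simp add: is_real_subring_def)
  have diff: "\<And>x y. x \<in> K \<Longrightarrow> y \<in> K \<Longrightarrow> x - y \<in> K"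
    using assms by (simp add: is_real_subring_def)
  show 0: "0 \<in> K" using diff[OF 1 1] by simp
  have neg: "\<And>x. x \<in> K \<Longrightarrow> - x \<in> K" using diff[OF 0] by fastforce
  have add: "\<And>x y. x \<in> K \<Longrightarrow> y \<in> K \<Longrightarrow> x + y \<in> K"
    using diff neg by (metis diff_minus_eq_add)
  show "x \<in> K \<Longrightarrow> - x \<in> K" by (rule neg)
  show "x \<in> K \<Longrightarrow> y \<in> K \<Longrightarrow> x - y \<in> K" by (rule diff)
  show "x \<in> K \<Longrightarrow> y \<in> K \<Longrightarrow> x + y \<in> K" by (rule add)
  show "2 \<in> K" using add[OF 1 1] by simp
  have mult: "\<And>x y. x \<in> K \<Longrightarrow> y \<in> K \<Longrightarrow> x * y \<in> K"
    using assms by (simp add: is_real_subring_def)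
  show "x \<in> K \<Longrightarrow> y \<in> K \<Longrightarrow> x * y \<in> K" by (rule mult)
  show "x \<in> K \<Longrightarrow> x ^ k \<in> K" by (induction k) (use 1 mult in auto)
qed

lemma is_real_subring_sum:
  assumes "is_real_subring K" "\<And>i. i \<in> I \<Longrightarrow> f i \<in> K"
  shows "sum f I \<in> K"
  using assms(2) is_real_subringD[OF assms(1)]
  by (induction I rule: infinite_finite_induct) auto

lemma is_real_subring_Ints: "is_real_subring \<int>"
  and is_real_subring_Rats: "is_real_subring \<rat>"
  by (auto simp: is_real_subring_def)

section \<open>The reals as a HOL-Algebra ring and their subfields\<close>

lemma real_ring_sel [simp]:
  "carrier real_ring = UNIV" "x \<otimes>\<^bsub>real_ring\<^esub> y = x * y" "x \<oplus>\<^bsub>real_ring\<^esub> y = x + y"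
  "\<one>\<^bsub>real_ring\<^esub> = 1" "\<zero>\<^bsub>real_ring\<^esub> = 0"
  by (simp_all add: ring_of_type_algebra_def)

interpretation real_ring: ring real_ring
  by (rule ring_from_type_algebra)

lemma real_ring_a_inv [simp]: "\<ominus>\<^bsub>real_ring\<^esub> x = - (x :: real)"
  by (rule real_ring.minus_equality) auto

lemma real_ring_m_inv [simp]:
  assumes "x \<noteq> 0"
  shows "inv\<^bsub>real_ring\<^esub> x = inverse (x :: real)"
  by (rule real_ring.inv_char) (use assms in auto)

text \<open>Since \<open>inverse 0 = 0\<close>, closure under inverses can be stated for all
  elements, zero included.\<close>

definition is_real_field :: "real set \<Rightarrow> bool" where
  "is_real_field K \<longleftrightarrow> is_real_subring K \<and> (\<forall>x\<in>K. inverse x \<in> K)"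

lemma is_real_fieldD:
  assumes "is_real_field K"
  shows "0 \<in> K" "1 \<in> K" "x \<in> K \<Longrightarrow> - x \<in> K" "x \<in> K \<Longrightarrow> inverse x \<in> K"
    "x \<in> K \<Longrightarrow> y \<in> K \<Longrightarrow> x + y \<in> K" "x \<in> K \<Longrightarrow> y \<in> K \<Longrightarrow> x - y \<in> K"
    "x \<in> K \<Longrightarrow> y \<in> K \<Longrightarrow> x * y \<in> K"
  using assms is_real_subringD[of K] by (auto simp: is_real_field_def)

lemma subfield_iff_is_real_field: "subfield K real_ring \<longleftrightarrow> is_real_field K"
proof
  assume K: "subfield K real_ring"
  note props = subringE[OF subfieldE(1)[OF K]]
  have "inverse x \<in> K" if "x \<in> K" for x
    using real_ring.subfield_m_inv(1)[OF K, of x] that props(2)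
    by (cases "x = 0") auto
  thus "is_real_field K"
    unfolding is_real_field_def is_real_subring_def using props(3,5-7)
    by (auto simp: diff_conv_add_uminus simp del: add_uminus_conv_diff)
next
  assume K: "is_real_field K"
  note props = is_real_fieldD[OF K]
  show "subfield K real_ring"
  proof (rule field.subfieldI'[OF field_from_type_algebra])
    show "subring K real_ring"
      by (rule real_ring.subringI) (use props in auto)
    show "inv\<^bsub>real_ring\<^esub> k \<in> K" if "k \<in> K - {\<zero>\<^bsub>real_ring\<^esub>}" for k
      using that props by simp
  qed
qed

lemma is_real_field_Rats: "is_real_field \<rat>"
  by (auto simp: is_real_field_def is_real_subring_Rats)

section \<open>Coordinates over a subfield and change of basis\<close>

lemma sum_mult_swap:
  fixes f :: "'a \<Rightarrow> 'b \<Rightarrow> 'c :: comm_semiring_0"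
  shows "(\<Sum>i\<in>I. (\<Sum>k\<in>J. f i k * g k) * h i) = (\<Sum>k\<in>J. g k * (\<Sum>i\<in>I. f i k * h i))"
  unfolding sum_distrib_left sum_distrib_right by (subst sum.swap) (simp add: mult_ac)

lemma combine_eq_sum:
  "length Ks = length Us \<Longrightarrow>
     real_ring.combine Ks Us = (\<Sum>i<length Us. Ks ! i * Us ! i)"
  by (induction Ks Us rule: real_ring.combine.induct)
     (auto simp: sum.lessThan_Suc_shift simp del: sum.lessThan_Suc)

lemma Span_eq_sums:
  assumes "is_real_field K"
  shows "real_ring.Span K us = {\<Sum>i<length us. c i * us ! i | c. \<forall>i<length us. c i \<in> K}"
proof -
  have K: "subfield K real_ring" using assms by (simp add: subfield_iff_is_real_field)
  have "real_ring.Span K us = {real_ring.combine Ks us | Ks. length Ks = length us \<and> set Ks \<subseteq> K}"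
    by (rule real_ring.Span_eq_combine_set_length_version[OF K]) simp
  also have "\<dots> = {\<Sum>i<length us. c i * us ! i | c. \<forall>i<length us. c i \<in> K}"
  proof (intro equalityI subsetI)
    fix x assume "x \<in> {real_ring.combine Ks us | Ks. length Ks = length us \<and> set Ks \<subseteq> K}"
    then obtain Ks where "x = (\<Sum>i<length us. Ks ! i * us ! i)" "length Ks = length us" "set Ks \<subseteq> K"
      by (auto simp: combine_eq_sum)
    thus "x \<in> {\<Sum>i<length us. c i * us ! i | c. \<forall>i<length us. c i \<in> K}"
      by (auto intro!: exI[of _ "(!) Ks"])
  next
    fix x assume "x \<in> {\<Sum>i<length us. c i * us ! i | c. \<forall>i<length us. c i \<in> K}"
    then obtain c where c: "x = (\<Sum>i<length us. c i * us ! i)" "\<forall>i<length us. c i \<in> K"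
      by blast
    thus "x \<in> {real_ring.combine Ks us | Ks. length Ks = length us \<and> set Ks \<subseteq> K}"
      by (intro CollectI exI[of _ "map c [0..<length us]"]) (auto simp: combine_eq_sum)
  qed
  finally show ?thesis .
qed

lemma independent_iff_sums:
  assumes "is_real_field K"
  shows "real_ring.independent K us \<longleftrightarrow>
    (\<forall>c. (\<forall>i<length us. c i \<in> K) \<longrightarrow> (\<Sum>i<length us. c i * us ! i) = 0 \<longrightarrow> (\<forall>i<length us. c i = 0))"
    (is "_ \<longleftrightarrow> ?R")
proof
  have K: "subfield K real_ring" using assms by (simp add: subfield_iff_is_real_field)
  show ?R if ind: "real_ring.independent K us"
  proof (intro allI impI)
    fix c i assume c: "\<forall>i<length us. c i \<in> K" "(\<Sum>i<length us. c i * us ! i) = 0" and i: "i < length us"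
    have "set (take (length us) (map c [0..<length us])) \<subseteq> {\<zero>\<^bsub>real_ring\<^esub>}"
      by (rule real_ring.independent_imp_trivial_combine[OF K ind]) (use c in \<open>auto simp: combine_eq_sum\<close>)
    thus "c i = 0" using i by (auto simp: image_subset_iff)
  qed
  show "real_ring.independent K us" if R: ?R
  proof (rule ccontr)
    assume "\<not> real_ring.independent K us"
    then obtain Ks where Ks: "length Ks = length us" "real_ring.combine Ks us = \<zero>\<^bsub>real_ring\<^esub>"
      "set Ks \<subseteq> K" "set Ks \<noteq> {\<zero>\<^bsub>real_ring\<^esub>}"
      using real_ring.dependent_imp_non_trivial_combine[OF K, of us] by auto
    have us: "us \<noteq> []" using \<open>\<not> real_ring.independent K us\<close> by auto
    have mem: "\<forall>i<length us. Ks ! i \<in> K" using Ks(1,3) nth_mem by fastforce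
    have sum0: "(\<Sum>i<length us. Ks ! i * us ! i) = 0" using Ks by (simp add: combine_eq_sum)
    have "\<forall>i<length us. Ks ! i = 0"
      using R[THEN spec, THEN mp, OF mem, THEN mp, OF sum0] .
    hence "set Ks \<subseteq> {0}" using Ks(1) by (metis in_set_conv_nth insertI1 subsetI)
    moreover have "set Ks \<noteq> {}" using us Ks(1) by auto
    ultimately show False using Ks(4) by (metis real_ring_sel(5) subset_singletonD)
  qed
qed

lemma field_basis_iff_sums:
  assumes "is_real_field K"
  shows "field_basis K L us \<longleftrightarrow>
    (\<forall>c. (\<forall>i<length us. c i \<in> K) \<longrightarrow> (\<Sum>i<length us. c i * us ! i) = 0 \<longrightarrow> (\<forall>i<length us. c i = 0)) \<and>
    L = {\<Sum>i<length us. c i * us ! i | c. \<forall>i<length us. c i \<in> K}"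
  unfolding field_basis_def Span_eq_sums[OF assms] independent_iff_sums[OF assms] by blast

lemma field_basis_unique:
  assumes "is_real_field K" "field_basis K L us"
    and "\<And>i. i < length us \<Longrightarrow> c i \<in> K" "\<And>i. i < length us \<Longrightarrow> d i \<in> K"
    and "(\<Sum>i<length us. c i * us ! i) = (\<Sum>i<length us. d i * us ! i)" and "i < length us"
  shows "c i = d i"
proof -
  have sum0: "(\<Sum>i<length us. (c i - d i) * us ! i) = 0"
    using assms(5) by (simp add: left_diff_distrib sum_subtractf)
  have mem: "\<forall>i<length us. c i - d i \<in> K"
    using assms(3,4) is_real_fieldD[OF assms(1)] by blast
  have indep: "\<forall>e. (\<forall>i<length us. e i \<in> K) \<longrightarrow> (\<Sum>i<length us. e i * us ! i) = 0 \<longrightarrow>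
      (\<forall>i<length us. e i = 0)"
    using assms(2) unfolding field_basis_iff_sums[OF assms(1)] by (rule conjunct1)
  have "c i - d i = 0"
    using indep[THEN spec, THEN mp, OF mem, THEN mp, OF sum0] assms(6) by blast
  thus ?thesis by simp
qed

lemma field_basis_mem:
  assumes "is_real_field K" "field_basis K L us" "i < length us"
  shows "us ! i \<in> L"
proof -
  define c :: "nat \<Rightarrow> real" where "c j = (if j = i then 1 else 0)" for j
  have "us ! i = (\<Sum>j<length us. c j * us ! j)"
    using assms(3) by (simp add: c_def if_distrib[of "\<lambda>x. x * _"] cong: if_cong)
  moreover have "\<forall>j<length us. c j \<in> K"
    using is_real_fieldD[OF assms(1)] by (simp add: c_def)
  moreover have "L = {\<Sum>i<length us. c i * us ! i | c. \<forall>i<length us. c i \<in> K}"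
    using assms(2) unfolding field_basis_iff_sums[OF assms(1)] by (rule conjunct2)
  ultimately show ?thesis by blast
qed

lemma field_basis_transition:
  assumes K: "is_real_field K" and us: "field_basis K L us" and vs: "field_basis K L vs"
  obtains P where "\<And>i j. i < length us \<Longrightarrow> j < length vs \<Longrightarrow> P i j \<in> K"
    "\<And>j. j < length vs \<Longrightarrow> vs ! j = (\<Sum>i<length us. P i j * us ! i)"
proof -
  have "\<forall>j. \<exists>c. j < length vs \<longrightarrow> (\<forall>i<length us. c i \<in> K) \<and> vs ! j = (\<Sum>i<length us. c i * us ! i)"
    using field_basis_mem[OF K vs] us unfolding field_basis_iff_sums[OF K] by blast
  then obtain P where "\<forall>j<length vs. (\<forall>i<length us. P j i \<in> K) \<and> vs ! j = (\<Sum>i<length us. P j i * us ! i)"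
    by metis
  thus thesis using that[of "\<lambda>i j. P j i"] by blast
qed

lemma is_real_field_sum:
  "is_real_field K \<Longrightarrow> (\<And>i. i \<in> I \<Longrightarrow> f i \<in> K) \<Longrightarrow> sum f I \<in> K"
  by (simp add: is_real_field_def is_real_subring_sum)

text \<open>Expressing \<open>us ! j\<close> through \<open>v\<close> and then back through
  \<open>us\<close> yields a second coordinate vector of the same element; uniqueness of coordinates
  identifies the matrix product with the identity.\<close>

lemma field_basis_transition_inverse:
  assumes K: "is_real_field K" and us: "field_basis K L us"
    and P: "\<And>i j. i < length us \<Longrightarrow> j < m \<Longrightarrow> P i j \<in> K"
      "\<And>j. j < m \<Longrightarrow> v j = (\<Sum>i<length us. P i j * us ! i)"
    and Q: "\<And>i j. i < m \<Longrightarrow> j < length us \<Longrightarrow> Q i j \<in> K"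
      "\<And>j. j < length us \<Longrightarrow> us ! j = (\<Sum>i<m. Q i j * v i)"
    and ij: "i < length us" "j < length us"
  shows "(\<Sum>k<m. P i k * Q k j) = (if i = j then 1 else 0)"
proof (rule field_basis_unique[OF K us _ _ _ ij(1), where c="\<lambda>i. \<Sum>k<m. P i k * Q k j"
      and d="\<lambda>i. if i = j then 1 else 0"])
  show "(\<Sum>k<m. P i k * Q k j) \<in> K" if "i < length us" for i
    using that P(1) Q(1) ij(2) is_real_fieldD(7)[OF K] by (intro is_real_field_sum[OF K]) auto
  show "(if i = j then 1 else 0) \<in> K" for i using is_real_fieldD[OF K] by auto
  have "(\<Sum>i<length us. (\<Sum>k<m. P i k * Q k j) * us ! i) = (\<Sum>k<m. Q k j * (\<Sum>i<length us. P i k * us ! i))"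
    by (rule sum_mult_swap)
  also have "\<dots> = us ! j" using P(2) Q(2)[OF ij(2)] by simp
  also have "\<dots> = (\<Sum>i<length us. (if i = j then 1 else 0) * us ! i)"
    using ij(2) by (simp add: if_distrib[of "\<lambda>x. x * _"] cong: if_cong)
  finally show "(\<Sum>i<length us. (\<Sum>k<m. P i k * Q k j) * us ! i) =
    (\<Sum>i<length us. (if i = j then 1 else 0) * us ! i)" .
qed

text \<open>Both sides are the coordinates of \<open>x * vs ! j\<close> in the basis
  \<open>us\<close>; as matrices, \<open>A P = P B\<close>.\<close>

lemma mult_matrix_change_basis:
  assumes K: "is_real_field K" and us: "field_basis K L us"
    and A: "is_mult_matrix K us x A" and B: "is_mult_matrix K vs x B"
    and P: "\<And>i j. i < length us \<Longrightarrow> j < length vs \<Longrightarrow> P i j \<in> K"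
      "\<And>j. j < length vs \<Longrightarrow> vs ! j = (\<Sum>i<length us. P i j * us ! i)"
    and i: "i < length us" and j: "j < length vs"
  shows "(\<Sum>k<length us. A $$ (i, k) * P k j) = (\<Sum>k<length vs. P i k * B $$ (k, j))"
proof (rule field_basis_unique[OF K us _ _ _ i, where c="\<lambda>i. \<Sum>k<length us. A $$ (i, k) * P k j"
      and d="\<lambda>i. \<Sum>k<length vs. P i k * B $$ (k, j)"])
  show "(\<Sum>k<length us. A $$ (i, k) * P k j) \<in> K" if "i < length us" for i
    using that P(1) A j is_real_fieldD(7)[OF K]
    by (intro is_real_field_sum[OF K]) (auto simp: is_mult_matrix_def)
  show "(\<Sum>k<length vs. P i k * B $$ (k, j)) \<in> K" if "i < length us" for i
    using that P(1) B j is_real_fieldD(7)[OF K]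
    by (intro is_real_field_sum[OF K]) (auto simp: is_mult_matrix_def)
  have "(\<Sum>i<length us. (\<Sum>k<length us. A $$ (i, k) * P k j) * us ! i) =
      (\<Sum>k<length us. P k j * (\<Sum>i<length us. A $$ (i, k) * us ! i))"
    by (rule sum_mult_swap)
  also have "\<dots> = (\<Sum>k<length us. P k j * (x * us ! k))"
    using A by (intro sum.cong) (auto simp: is_mult_matrix_def)
  also have "\<dots> = x * vs ! j" using P(2)[OF j] by (simp add: sum_distrib_left mult_ac)
  also have "\<dots> = (\<Sum>k<length vs. B $$ (k, j) * vs ! k)"
    using B j by (auto simp: is_mult_matrix_def)
  also have "\<dots> = (\<Sum>k<length vs. B $$ (k, j) * (\<Sum>i<length us. P i k * us ! i))"
    using P(2) by simp
  also have "\<dots> = (\<Sum>i<length us. (\<Sum>k<length vs. P i k * B $$ (k, j)) * us ! i)"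
    by (rule sum_mult_swap[symmetric])
  finally show "(\<Sum>i<length us. (\<Sum>k<length us. A $$ (i, k) * P k j) * us ! i) =
    (\<Sum>i<length us. (\<Sum>k<length vs. P i k * B $$ (k, j)) * us ! i)" .
qed

text \<open>The transition matrices are inverse to each other and intertwine \<open>A\<close> and
  \<open>B\<close>, so these are similar. This makes the definite descriptions of norm and trace
  well-defined.\<close>

lemma mult_matrix_basis_independent:
  assumes K: "is_real_field K" and us: "field_basis K L us" and vs: "field_basis K L vs"
    and A: "is_mult_matrix K us x A" and B: "is_mult_matrix K vs x B"
  shows "det A = det B"
    and "(\<Sum>i<length us. A $$ (i, i)) = (\<Sum>i<length vs. B $$ (i, i))"
proof -
  define m l where "m = length us" and "l = length vs"
  obtain P where P: "\<And>i j. i < m \<Longrightarrow> j < l \<Longrightarrow> P i j \<in> K"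
    "\<And>j. j < l \<Longrightarrow> vs ! j = (\<Sum>i<m. P i j * us ! i)"
    unfolding m_def l_def using field_basis_transition[OF K us vs] by blast
  obtain Q where Q: "\<And>i j. i < l \<Longrightarrow> j < m \<Longrightarrow> Q i j \<in> K"
    "\<And>j. j < m \<Longrightarrow> us ! j = (\<Sum>i<l. Q i j * vs ! i)"
    unfolding m_def l_def using field_basis_transition[OF K vs us] by blast
  have PQ: "(\<Sum>k<l. P i k * Q k j) = (if i = j then 1 else 0)" if "i < m" "j < m" for i j
    using field_basis_transition_inverse[OF K us, of l P "(!) vs" Q] P Q that by (auto simp: m_def l_def)
  have QP: "(\<Sum>k<m. Q i k * P k j) = (if i = j then 1 else 0)" if "i < l" "j < l" for i j
    using field_basis_transition_inverse[OF K vs, of m Q "(!) us" P] P Q that by (auto simp: m_def l_def)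
  have AP: "(\<Sum>k<m. A $$ (i, k) * P k j) = (\<Sum>k<l. P i k * B $$ (k, j))" if "i < m" "j < l" for i j
    using mult_matrix_change_basis[OF K us A B, of P] P that by (auto simp: m_def l_def)
  \<comment> \<open>\<open>P Q\<close> and \<open>Q P\<close> are identity matrices with the same
    trace, so the two bases have equal length.\<close>
  have "real m = (\<Sum>i<m. \<Sum>k<l. P i k * Q k i)" by (simp add: PQ)
  also have "\<dots> = (\<Sum>k<l. \<Sum>i<m. Q k i * P i k)" by (subst sum.swap) (simp add: mult_ac)
  also have "\<dots> = real l" by (simp add: QP)
  finally have lm: "l = m" by simp
  have Am: "A \<in> carrier_mat m m" and Bm: "B \<in> carrier_mat m m"
    using A B lm by (auto simp: is_mult_matrix_def m_def l_def)
  define MP MQ where "MP = mat m m (\<lambda>(i, j). P i j)" and "MQ = mat m m (\<lambda>(i, j). Q i j)"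
  have MPQ: "MP \<in> carrier_mat m m" "MQ \<in> carrier_mat m m" by (simp_all add: MP_def MQ_def)
  have eq1: "MP * MQ = 1\<^sub>m m" and eq2: "MQ * MP = 1\<^sub>m m"
    by (rule eq_matI; use PQ QP lm in \<open>simp add: MP_def MQ_def scalar_prod_def lessThan_atLeast0\<close>)+
  have eq3: "A * MP = MP * B"
    by (rule eq_matI; use AP lm Am Bm in \<open>simp add: MP_def scalar_prod_def lessThan_atLeast0\<close>)
  have "A = A * (MP * MQ)" using Am eq1 by simp
  also have "\<dots> = MP * B * MQ" using Am Bm MPQ eq3 by (metis assoc_mult_mat)
  finally have "similar_mat A B"
    unfolding similar_mat_def similar_mat_wit_def using Am Bm MPQ eq1 eq2
    by (intro exI[of _ MP] exI[of _ MQ]) (auto simp: Let_def)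
  thus "det A = det B" by (rule det_similar)
  \<comment> \<open>Cyclicity of the trace by hand: insert \<open>P Q = 1\<close>, replace
    \<open>A P\<close> by \<open>P B\<close>, then cancel \<open>Q P = 1\<close>.\<close>
  have "(\<Sum>i<m. A $$ (i, i)) = (\<Sum>i<m. \<Sum>k<m. A $$ (i, k) * (if k = i then 1 else 0))"
    by (simp add: if_distrib cong: if_cong)
  also have "\<dots> = (\<Sum>i<m. \<Sum>k<m. A $$ (i, k) * (\<Sum>h<m. P k h * Q h i))"
    using PQ lm by simp
  also have "\<dots> = (\<Sum>i<m. \<Sum>h<m. (\<Sum>k<m. A $$ (i, k) * P k h) * Q h i)"
  proof (rule sum.cong[OF refl])
    fix i
    show "(\<Sum>k<m. A $$ (i, k) * (\<Sum>h<m. P k h * Q h i)) = (\<Sum>h<m. (\<Sum>k<m. A $$ (i, k) * P k h) * Q h i)"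
      using sum_mult_swap[of "\<lambda>h k. P k h" "\<lambda>k. A $$ (i, k)" "{..<m}" "\<lambda>h. Q h i" "{..<m}"]
      by (simp add: mult.commute)
  qed
  also have "\<dots> = (\<Sum>i<m. \<Sum>h<m. (\<Sum>k<m. P i k * B $$ (k, h)) * Q h i)"
    using AP lm by simp
  also have "\<dots> = (\<Sum>h<m. \<Sum>i<m. (\<Sum>k<m. P i k * B $$ (k, h)) * Q h i)"
    by (rule sum.swap)
  also have "\<dots> = (\<Sum>h<m. \<Sum>k<m. (\<Sum>i<m. Q h i * P i k) * B $$ (k, h))"
  proof (rule sum.cong[OF refl])
    fix h
    show "(\<Sum>i<m. (\<Sum>k<m. P i k * B $$ (k, h)) * Q h i) = (\<Sum>k<m. (\<Sum>i<m. Q h i * P i k) * B $$ (k, h))"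
      using sum_mult_swap[of "\<lambda>i k. P i k" "\<lambda>k. B $$ (k, h)" "{..<m}" "\<lambda>i. Q h i" "{..<m}"]
      by (simp add: mult.commute)
  qed
  also have "\<dots> = (\<Sum>h<m. \<Sum>k<m. (if h = k then 1 else 0) * B $$ (k, h))"
    using QP lm by simp
  also have "\<dots> = (\<Sum>h<m. B $$ (h, h))"
    by (simp add: if_distrib[of "\<lambda>x. x * _"] cong: if_cong)
  finally show "(\<Sum>i<length us. A $$ (i, i)) = (\<Sum>i<length vs. B $$ (i, i))"
    using lm by (simp add: m_def l_def)
qed

lemma field_norm_eq_det:
  assumes "is_real_field K" "field_basis K L us" "is_mult_matrix K us x A"
  shows "field_norm L K x = det A"
  unfolding field_norm_def
  by (rule the_equality) (use assms mult_matrix_basis_independent(1) in blast)+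

lemma field_trace_eq_sum:
  assumes "is_real_field K" "field_basis K L us" "is_mult_matrix K us x A"
  shows "field_trace L K x = (\<Sum>i<length us. A $$ (i, i))"
  unfolding field_trace_def
  by (rule the_equality) (use assms mult_matrix_basis_independent(2) in blast)+

section \<open>Adjoining an element\<close>

definition poly_over :: "real set \<Rightarrow> real poly \<Rightarrow> bool" where
  "poly_over K p \<longleftrightarrow> (\<forall>i. Polynomial.coeff p i \<in> K)"

lemma poly_over_pCons:
  "poly_over K (pCons a p) \<longleftrightarrow> a \<in> K \<and> poly_over K p"
  unfolding poly_over_def by (auto simp: coeff_pCons split: nat.splits)

lemma poly_over_induct [consumes 1, case_names 0 pCons]:
  assumes "poly_over K p"
    and "P 0" and "\<And>a p. a \<in> K \<Longrightarrow> poly_over K p \<Longrightarrow> P p \<Longrightarrow> P (pCons a p)"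
  shows "P p"
  using assms(1)
proof (induction p)
  case (pCons a p)
  thus ?case using assms(3) by (simp add: poly_over_pCons)
qed (rule assms)

context
  fixes K assumes K: "is_real_subring K"
begin

lemma poly_over_0: "poly_over K 0"
  using is_real_subringD[OF K] by (simp add: poly_over_def)

lemma poly_over_const: "a \<in> K \<Longrightarrow> poly_over K [:a:]"
  by (simp add: poly_over_pCons poly_over_0)

lemma poly_over_diff: "poly_over K p \<Longrightarrow> poly_over K q \<Longrightarrow> poly_over K (p - q)"
  using is_real_subringD[OF K] by (simp add: poly_over_def)

lemma poly_over_add: "poly_over K p \<Longrightarrow> poly_over K q \<Longrightarrow> poly_over K (p + q)"
  using is_real_subringD[OF K] by (simp add: poly_over_def)

lemma poly_over_mult: "poly_over K p \<Longrightarrow> poly_over K q \<Longrightarrow> poly_over K (p * q)"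
  unfolding poly_over_def coeff_mult
  using is_real_subringD[OF K] by (intro allI is_real_subring_sum[OF K]) auto

lemma poly_over_pcompose: "poly_over K p \<Longrightarrow> poly_over K q \<Longrightarrow> poly_over K (p \<circ>\<^sub>p q)"
proof (induction p rule: poly_over_induct)
  case (pCons a p)
  thus ?case by (simp add: pcompose_pCons poly_over_add poly_over_mult poly_over_const)
qed (simp_all add: poly_over_0)

end

definition adjoin :: "real set \<Rightarrow> real \<Rightarrow> real set" where
  "adjoin K t = {poly p t | p. poly_over K p}"

lemma adjoinI: "poly_over K p \<Longrightarrow> poly p t \<in> adjoin K t"
  unfolding adjoin_def by blast

lemma is_real_subring_adjoin:
  assumes K: "is_real_subring K"
  shows "is_real_subring (adjoin K t)"
  unfolding is_real_subring_def
proof (intro conjI ballI)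
  show "1 \<in> adjoin K t"
    using adjoinI[OF poly_over_const[OF K is_real_subringD(2)[OF K]]] by simp
  fix x y assume "x \<in> adjoin K t" "y \<in> adjoin K t"
  then obtain p q where pq: "poly_over K p" "poly_over K q" "x = poly p t" "y = poly q t"
    unfolding adjoin_def by blast
  show "x - y \<in> adjoin K t"
    using adjoinI[OF poly_over_diff[OF K pq(1,2)], of t] pq by simp
  show "x * y \<in> adjoin K t"
    using adjoinI[OF poly_over_mult[OF K pq(1,2)], of t] pq by simp
qed

lemma adjoin_base: "is_real_subring K \<Longrightarrow> a \<in> K \<Longrightarrow> a \<in> adjoin K t"
  using adjoinI[OF poly_over_const, of K a t] by simp

lemma adjoin_gen: "is_real_subring K \<Longrightarrow> t \<in> adjoin K t"
  using adjoinI[of K "[:0, 1:]" t] by (simp add: poly_over_pCons poly_over_0 is_real_subringD)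

lemma adjoin_subset:
  assumes "is_real_subring K" "is_real_subring R" "K \<subseteq> R" "t \<in> R"
  shows "adjoin K t \<subseteq> R"
proof
  fix x assume "x \<in> adjoin K t"
  then obtain p where "poly_over K p" and x: "x = poly p t" unfolding adjoin_def by blast
  from this(1) have "poly p t \<in> R"
    by (induction p rule: poly_over_induct)
       (use is_real_subringD[OF assms(2)] assms(3,4) in auto)
  with x show "x \<in> R" by simp
qed

lemma adjoin_split:
  assumes K: "is_real_subring K" and "x \<in> adjoin K t"
  obtains a y where "a \<in> K" "y \<in> adjoin K t" "x = a + t * y"
proof -
  obtain p where p: "poly_over K p" and x: "x = poly p t"
    using assms(2) unfolding adjoin_def by blast
  show thesis
  proof (cases p)
    case (pCons a q)
    with p have "a \<in> K" "poly_over K q" by (simp_all add: poly_over_pCons)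
    thus ?thesis using that[of a "poly q t"] x pCons by (simp add: adjoinI)
  qed
qed

text \<open>Even and odd powers of \<open>t\<close> are separated along Horner's scheme, where
  multiplication by \<open>t\<close> interchanges the two parts:
  \<open>a + t * (y + t * z) = (a + t\<^sup>2 * z) + t * y\<close>.\<close>

lemma adjoin_square_split:
  assumes K: "is_real_subring K" and "x \<in> adjoin K t"
  obtains y z where "y \<in> adjoin K (t\<^sup>2)" "z \<in> adjoin K (t\<^sup>2)" "x = y + t * z"
proof -
  note R = is_real_subringD[OF is_real_subring_adjoin[OF K, of "t\<^sup>2"]]
  obtain p where p: "poly_over K p" and x: "x = poly p t"
    using assms(2) unfolding adjoin_def by blast
  from p have "\<exists>y\<in>adjoin K (t\<^sup>2). \<exists>z\<in>adjoin K (t\<^sup>2). poly p t = y + t * z"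
  proof (induction p rule: poly_over_induct)
    case 0
    show ?case using R(1) by (auto intro!: bexI[of _ 0])
  next
    case (pCons a p)
    then obtain y z where yz: "y \<in> adjoin K (t\<^sup>2)" "z \<in> adjoin K (t\<^sup>2)" "poly p t = y + t * z"
      by blast
    have "a + t\<^sup>2 * z \<in> adjoin K (t\<^sup>2)"
      using R(5,7) yz(2) adjoin_gen[OF K] adjoin_base[OF K pCons(1)] by blast
    moreover have "poly (pCons a p) t = (a + t\<^sup>2 * z) + t * y"
      by (simp add: yz(3) algebra_simps power2_eq_square)
    ultimately show ?case using yz(1) by blast
  qed
  thus thesis using that x by blast
qed

section \<open>The cosine basis\<close>

text \<open>This is \<open>\<zeta> ^ k + \<zeta> ^ (- k)\<close> for a primitive root of unity
  \<open>\<zeta>\<close> of order \<open>2 ^ (n + 2)\<close>; the factor 2 makes it an algebraic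
  integer.\<close>

definition bcos :: "nat \<Rightarrow> nat \<Rightarrow> real" where
  "bcos n k = 2 * cos (real k * pi / 2 ^ (n + 1))"

text \<open>For odd \<open>m\<close>, the numbers \<open>cos_basis n m k\<close> with \<open>k < 2 ^ n\<close> are the conjugates of the
  integral basis \<open>cos_basis n 1 k\<close> of \<open>B_field n\<close> under the automorphism that maps a primitive
  root of unity \<open>\<zeta>\<close> of order \<open>2 ^ (n + 2)\<close> to \<open>\<zeta> ^ m\<close>.\<close>

definition cos_basis :: "nat \<Rightarrow> nat \<Rightarrow> nat \<Rightarrow> real" where
  "cos_basis n m k = (if k = 0 then 1 else bcos n (m * k))"

lemma bcos_0 [simp]: "bcos n 0 = 2"
  by (simp add: bcos_def)

lemma bcos_Suc_double: "bcos (Suc n) (2 * k) = bcos n k"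
  by (simp add: bcos_def field_simps)

lemma bcos_mult:
  assumes "j \<le> k"
  shows "bcos n j * bcos n k = bcos n (k + j) + bcos n (k - j)"
proof -
  have "2 * cos x * (2 * cos y) = 2 * cos (y + x) + 2 * cos (y - x)" for x y :: real
    by (simp add: cos_add cos_diff)
  moreover have "real (k + j) * pi / 2 ^ (n + 1) = real k * pi / 2 ^ (n + 1) + real j * pi / 2 ^ (n + 1)"
    "real (k - j) * pi / 2 ^ (n + 1) = real k * pi / 2 ^ (n + 1) - real j * pi / 2 ^ (n + 1)"
    using assms by (simp_all add: of_nat_diff add_divide_distrib diff_divide_distrib algebra_simps)
  ultimately show ?thesis unfolding bcos_def by presburger
qed

lemma bcos_square: "(bcos n k)\<^sup>2 = 2 + bcos n (2 * k)"
  using bcos_mult[of k k n] by (simp add: power2_eq_square mult_2)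

lemma bcos_eq_0_iff: "bcos n k = 0 \<longleftrightarrow> (\<exists>i. odd i \<and> k = i * 2 ^ n)"
proof
  assume "bcos n k = 0"
  hence "cos (real k * pi / 2 ^ (n + 1)) = 0" by (simp add: bcos_def)
  then obtain i where i: "odd i" "real k * pi / 2 ^ (n + 1) = of_int i * (pi / 2)"
    unfolding cos_zero_iff_int by blast
  hence "real k = of_int i * 2 ^ n" by (simp add: field_simps)
  moreover have "i > 0"
  proof -
    have "0 \<le> real_of_int i * 2 ^ n" using calculation by (metis of_nat_0_le_iff)
    moreover have "real_of_int i * 2 ^ n < 0" if "i < 0" using that by (simp add: mult_neg_pos)
    ultimately have "i \<ge> 0" by linarith
    moreover have "i \<noteq> 0" using i(1) by auto
    ultimately show ?thesis by simp
  qed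
  ultimately have "real k = real (nat i * 2 ^ n)" by simp
  hence "k = nat i * 2 ^ n" by (rule of_nat_eq_iff[THEN iffD1])
  moreover have "odd (nat i)" using i(1) \<open>i > 0\<close> by (simp add: even_nat_iff)
  ultimately show "\<exists>i. odd i \<and> k = i * 2 ^ n" by blast
next
  assume "\<exists>i. odd i \<and> k = i * 2 ^ n"
  then obtain i where i: "odd i" "k = i * 2 ^ n" by blast
  hence "real k * pi / 2 ^ (n + 1) = of_int (int i) * (pi / 2)" by (simp add: field_simps)
  moreover have "odd (int i)" using i by simp
  ultimately show "bcos n k = 0" unfolding bcos_def using cos_zero_iff_int by (metis mult_zero_right)
qed

lemma cos_nat_pi_add: "cos (real i * pi + x) = (- 1) ^ i * cos x"
  by (simp add: cos_add mult.commute[of _ pi])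

lemma bcos_shift: "bcos n (i * 2 ^ (n + 1) + k) = (- 1) ^ i * bcos n k"
proof -
  have "real (i * 2 ^ (n + 1) + k) * pi / 2 ^ (n + 1) = real i * pi + real k * pi / 2 ^ (n + 1)"
    by (simp add: field_simps)
  thus ?thesis unfolding bcos_def using cos_nat_pi_add by simp
qed

lemma bcos_reflect:
  assumes "k \<le> i * 2 ^ (n + 1)"
  shows "bcos n (i * 2 ^ (n + 1) - k) = (- 1) ^ i * bcos n k"
proof -
  have "real (i * 2 ^ (n + 1) - k) * pi / 2 ^ (n + 1) = real i * pi + (- (real k * pi / 2 ^ (n + 1)))"
    using assms by (simp add: field_simps of_nat_diff)
  thus ?thesis unfolding bcos_def using cos_nat_pi_add[of i "- (real k * pi / 2 ^ (n + 1))"] by simp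
qed

text \<open>The multipliers \<open>2 * i + 1\<close> represent the odd residues modulo
  \<open>2 ^ (n + 2)\<close> up to sign, one for each conjugate, so the sum is a trace. Multiplied
  by \<open>sin \<phi>\<close> it telescopes to \<open>sin (j * pi) = 0\<close>.\<close>

lemma sum_bcos_odd:
  assumes "0 < j" "j < 2 ^ (n + 1)"
  shows "(\<Sum>i<2 ^ n. bcos n ((2 * i + 1) * j)) = 0"
proof -
  define \<phi> where "\<phi> = real j * pi / 2 ^ (n + 1)"
  have "real j < 2 ^ (n + 1)" using assms(2) by (metis of_nat_less_iff of_nat_numeral of_nat_power)
  hence "\<phi> < pi" "\<phi> > 0" using assms(1) by (auto simp: \<phi>_def field_simps)
  hence "sin \<phi> > 0" by (intro sin_gt_zero) auto
  have telescope: "sin \<phi> * (\<Sum>i<M. 2 * cos (real (2 * i + 1) * \<phi>)) = sin (2 * real M * \<phi>)" for M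
  proof (induction M)
    case (Suc M)
    define x where "x = (2 * real M + 1) * \<phi>"
    have "sin (2 * real (Suc M) * \<phi>) - sin (2 * real M * \<phi>) = sin (x + \<phi>) - sin (x - \<phi>)"
      by (simp add: x_def algebra_simps)
    also have "\<dots> = sin \<phi> * (2 * cos x)" by (simp add: sin_add sin_diff)
    also have "2 * cos x = 2 * cos (real (2 * M + 1) * \<phi>)" by (simp add: x_def add.commute)
    finally show ?case unfolding sum.lessThan_Suc distrib_left Suc by linarith
  qed simp
  have "sin \<phi> * (\<Sum>i<2 ^ n. bcos n ((2 * i + 1) * j)) = sin (2 * 2 ^ n * \<phi>)"
  proof -
    have "bcos n ((2 * i + 1) * j) = 2 * cos (real (2 * i + 1) * \<phi>)" for i
      by (simp only: bcos_def \<phi>_def of_nat_mult mult.assoc times_divide_eq_right)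
    thus ?thesis using telescope[of "2 ^ n"] by simp
  qed
  also have "2 * 2 ^ n * \<phi> = real j * pi" by (simp add: \<phi>_def)
  finally show ?thesis using \<open>sin \<phi> > 0\<close> by simp
qed

text \<open>For \<open>j > 0\<close> the product formula leaves terms with indices
  \<open>k + j\<close> and \<open>k - j\<close>, both below \<open>2 ^ (n + 1)\<close>. Their sums
  vanish unless the index is 0, where every term is \<open>bcos n 0 = 2\<close>.\<close>

lemma cos_basis_orthogonal:
  assumes "j < 2 ^ n" "k < 2 ^ n"
  shows "(\<Sum>i<2 ^ n. cos_basis n (2 * i + 1) j * cos_basis n (2 * i + 1) k) =
    (if j \<noteq> k then 0 else if k = 0 then 2 ^ n else 2 * 2 ^ n)"
  using assms
proof (induction j k rule: linorder_wlog)
  case (le j k)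
  show ?case
  proof (cases "j = 0")
    case True
    thus ?thesis using sum_bcos_odd[of k n] le by (auto simp: cos_basis_def)
  next
    case False
    have "(\<Sum>i<2 ^ n. cos_basis n (2 * i + 1) j * cos_basis n (2 * i + 1) k)
        = (\<Sum>i<2 ^ n. bcos n ((2 * i + 1) * (k + j)) + bcos n ((2 * i + 1) * (k - j)))"
    proof (rule sum.cong[OF refl])
      fix i
      have "(2 * i + 1) * j \<le> (2 * i + 1) * k" using le(1) by (rule mult_le_mono2)
      from bcos_mult[OF this, of n] False le(1)
      show "cos_basis n (2 * i + 1) j * cos_basis n (2 * i + 1) k
          = bcos n ((2 * i + 1) * (k + j)) + bcos n ((2 * i + 1) * (k - j))"
        unfolding cos_basis_def distrib_left[symmetric] right_diff_distrib'[symmetric] by auto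
    qed
    also have "\<dots> = (\<Sum>i<2 ^ n. bcos n ((2 * i + 1) * (k - j)))"
      using sum_bcos_odd[of "k + j" n] False le by (simp add: sum.distrib)
    also have "\<dots> = (if j \<noteq> k then 0 else 2 * 2 ^ n)"
      using sum_bcos_odd[of "k - j" n] le by auto
    finally show ?thesis using False by simp
  qed
next
  case (sym j k)
  thus ?case by (auto simp: mult.commute)
qed

text \<open>A Parseval identity: by orthogonality the trace pairing is diagonal in the coefficients,
  with a smaller weight for the basis element 1.\<close>

lemma cos_basis_inner:
  assumes "\<And>m. odd m \<Longrightarrow> F m = (\<Sum>k<2 ^ n. c k * cos_basis n m k)"
    and "\<And>m. odd m \<Longrightarrow> G m = (\<Sum>k<2 ^ n. d k * cos_basis n m k)"
  shows "(\<Sum>i<2 ^ n. F (2 * i + 1) * G (2 * i + 1)) = 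
    (\<Sum>k<2 ^ n. c k * d k * (if k = 0 then 2 ^ n else 2 * 2 ^ n))"
proof -
  have "(\<Sum>i<2 ^ n. F (2 * i + 1) * G (2 * i + 1)) =
    (\<Sum>i<2 ^ n. \<Sum>j<2 ^ n. \<Sum>k<2 ^ n. c j * d k * (cos_basis n (2 * i + 1) j * cos_basis n (2 * i + 1) k))"
    using assms by (simp add: sum_product mult_ac)
  also have "\<dots> = (\<Sum>j<2 ^ n. \<Sum>k<2 ^ n. \<Sum>i<2 ^ n. c j * d k * (cos_basis n (2 * i + 1) j * cos_basis n (2 * i + 1) k))"
    by (subst sum.swap, rule sum.cong[OF refl], rule sum.swap)
  also have "\<dots> = (\<Sum>j<2 ^ n. \<Sum>k<2 ^ n. c j * d k * (if j \<noteq> k then 0 else if k = 0 then 2 ^ n else 2 * 2 ^ n))"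
    unfolding sum_distrib_left[symmetric] by (intro sum.cong refl) (simp only: cos_basis_orthogonal lessThan_iff)
  also have "\<dots> = (\<Sum>j<2 ^ n. \<Sum>k<2 ^ n. if j = k then c j * d k * (if k = 0 then 2 ^ n else 2 * 2 ^ n) else 0)"
    by (intro sum.cong refl) auto
  also have "\<dots> = (\<Sum>j<2 ^ n. c j * d j * (if j = 0 then 2 ^ n else 2 * 2 ^ n))"
    by (simp add: sum.delta')
  finally show ?thesis .
qed

text \<open>\<open>F m\<close> is to be read as the \<open>m\<close>-th conjugate of \<open>F 1\<close>; the coefficients do not depend
  on \<open>m\<close>.\<close>

definition cos_comb :: "real set \<Rightarrow> nat \<Rightarrow> (nat \<Rightarrow> real) \<Rightarrow> bool" where
  "cos_comb K n F \<longleftrightarrow>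
     (\<exists>c. (\<forall>k. c k \<in> K) \<and> (\<forall>m. odd m \<longrightarrow> F m = (\<Sum>k<2 ^ n. c k * cos_basis n m k)))"

lemma cos_comb_cong: "(\<And>m. odd m \<Longrightarrow> F m = G m) \<Longrightarrow> cos_comb K n F \<longleftrightarrow> cos_comb K n G"
  by (simp add: cos_comb_def)

context
  fixes K assumes K: "is_real_subring K"
begin

lemma cos_comb_add:
  assumes "cos_comb K n F" "cos_comb K n G"
  shows "cos_comb K n (\<lambda>m. F m + G m)"
proof -
  obtain c d where cd: "\<forall>k. c k \<in> K" "\<forall>m. odd m \<longrightarrow> F m = (\<Sum>k<2 ^ n. c k * cos_basis n m k)"
    "\<forall>k. d k \<in> K" "\<forall>m. odd m \<longrightarrow> G m = (\<Sum>k<2 ^ n. d k * cos_basis n m k)"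
    using assms unfolding cos_comb_def by blast
  show ?thesis unfolding cos_comb_def
    by (rule exI[of _ "\<lambda>k. c k + d k"])
       (use cd is_real_subringD[OF K] in \<open>simp add: distrib_right sum.distrib\<close>)
qed

lemma cos_comb_scale:
  assumes "a \<in> K" "cos_comb K n F"
  shows "cos_comb K n (\<lambda>m. a * F m)"
proof -
  obtain c where c: "\<forall>k. c k \<in> K" "\<forall>m. odd m \<longrightarrow> F m = (\<Sum>k<2 ^ n. c k * cos_basis n m k)"
    using assms(2) unfolding cos_comb_def by blast
  show ?thesis unfolding cos_comb_def
    by (rule exI[of _ "\<lambda>k. a * c k"])
       (use c assms(1) is_real_subringD[OF K] in \<open>simp add: sum_distrib_left mult.assoc\<close>)
qed

lemma cos_comb_0: "cos_comb K n (\<lambda>m. 0)"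
  unfolding cos_comb_def by (rule exI[of _ "\<lambda>_. 0"]) (simp add: is_real_subringD[OF K])

lemma cos_comb_sum: "(\<And>i. i \<in> I \<Longrightarrow> cos_comb K n (F i)) \<Longrightarrow> cos_comb K n (\<lambda>m. \<Sum>i\<in>I. F i m)"
  by (induction I rule: infinite_finite_induct) (auto intro: cos_comb_add cos_comb_0)

lemma cos_comb_basis:
  assumes "k < 2 ^ n"
  shows "cos_comb K n (\<lambda>m. cos_basis n m k)"
  unfolding cos_comb_def
  by (rule exI[of _ "\<lambda>j. if j = k then 1 else 0"])
     (use assms is_real_subringD[OF K] in \<open>simp add: if_distrib[of "\<lambda>x. x * _"] cong: if_cong\<close>)

text \<open>Both boundary indices are included because multiplication by \<open>bcos n m\<close>
  moves an index by one: index 0 gives twice the basis element 1, and index \<open>2 ^ n\<close>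
  gives 0 for every odd multiplier.\<close>

lemma cos_comb_bcos:
  assumes "k \<le> 2 ^ n"
  shows "cos_comb K n (\<lambda>m. bcos n (m * k))"
proof -
  consider "k = 0" | "0 < k" "k < 2 ^ n" | "k = 2 ^ n" using assms by linarith
  thus ?thesis
  proof cases
    case 1
    have "cos_comb K n (\<lambda>m. 2 * cos_basis n m 0)"
      by (intro cos_comb_scale cos_comb_basis is_real_subringD[OF K]) auto
    thus ?thesis using 1 by (simp add: cos_basis_def)
  next
    case 2
    thus ?thesis using cos_comb_basis[of k n] by (simp add: cos_basis_def)
  next
    case 3
    have "bcos n (m * k) = 0" if "odd m" for m using that 3 bcos_eq_0_iff by blast
    thus ?thesis using cos_comb_0 cos_comb_cong[of "\<lambda>m. bcos n (m * k)" "\<lambda>_. 0"] by simp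
  qed
qed

lemma cos_comb_bcos_mult:
  assumes "cos_comb K n F"
  shows "cos_comb K n (\<lambda>m. bcos n m * F m)"
proof -
  obtain c where c: "\<forall>k. c k \<in> K" "\<forall>m. odd m \<longrightarrow> F m = (\<Sum>k<2 ^ n. c k * cos_basis n m k)"
    using assms unfolding cos_comb_def by blast
  have "cos_comb K n (\<lambda>m. bcos n m * cos_basis n m k)" if k: "k < 2 ^ n" for k
  proof (cases "k = 0")
    case True
    thus ?thesis using cos_comb_bcos[of 1 n] by (simp add: cos_basis_def)
  next
    case False
    have "bcos n m * cos_basis n m k = bcos n (m * (k + 1)) + bcos n (m * (k - 1))" for m
      using bcos_mult[of m "m * k" n] False by (simp add: cos_basis_def algebra_simps)
    moreover have "cos_comb K n (\<lambda>m. bcos n (m * (k + 1)) + bcos n (m * (k - 1)))"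
      using k by (intro cos_comb_add cos_comb_bcos) auto
    ultimately show ?thesis by simp
  qed
  hence comb: "cos_comb K n (\<lambda>m. \<Sum>k<2 ^ n. c k * (bcos n m * cos_basis n m k))"
    using c(1) by (intro cos_comb_sum cos_comb_scale) auto
  have "bcos n m * F m = (\<Sum>k<2 ^ n. c k * (bcos n m * cos_basis n m k))" if "odd m" for m
    using c(2) that by (simp add: sum_distrib_left mult_ac)
  thus ?thesis
    by (subst cos_comb_cong[of _ "\<lambda>m. \<Sum>k<2 ^ n. c k * (bcos n m * cos_basis n m k)"]) (auto intro: comb)
qed

text \<open>Horner's scheme keeps a single coefficient vector valid for all odd \<open>m\<close>.
  This is what later carries statements about \<open>bcos n 1\<close> over to its
  conjugates.\<close>

lemma cos_comb_poly:
  "poly_over K p \<Longrightarrow> cos_comb K n (\<lambda>m. poly p (bcos n m))"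
proof (induction p rule: poly_over_induct)
  case 0
  thus ?case by (simp add: cos_comb_0)
next
  case (pCons a p)
  have "cos_comb K n (\<lambda>m. a * cos_basis n m 0 + bcos n m * poly p (bcos n m))"
    using pCons by (intro cos_comb_add cos_comb_scale cos_comb_basis cos_comb_bcos_mult) auto
  thus ?case by (simp add: cos_basis_def)
qed

end

text \<open>The rescaled Chebyshev polynomials \<open>2 T_k(x / 2)\<close>, which send
  \<open>2 cos \<theta>\<close> to \<open>2 cos (k \<theta>)\<close>. In this scaling they are
  integral and, for \<open>k > 0\<close>, monic.\<close>

fun chebyshev :: "nat \<Rightarrow> int poly" where
  "chebyshev 0 = [:2:]"
| "chebyshev (Suc 0) = [:0, 1:]"
| "chebyshev (Suc (Suc k)) = [:0, 1:] * chebyshev (Suc k) - chebyshev k"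

text \<open>The value 1 in place of 2 at index 0 makes the family monic in every degree, hence
  unitriangular over the integers with respect to the powers of the variable.\<close>

definition basis_poly :: "nat \<Rightarrow> int poly" where
  "basis_poly k = (if k = 0 then 1 else chebyshev k)"

lemma coeff_chebyshev:
  "i > k \<Longrightarrow> Polynomial.coeff (chebyshev k) i = 0"
  "k > 0 \<Longrightarrow> Polynomial.coeff (chebyshev k) k = 1"
  by (induction k arbitrary: i rule: chebyshev.induct)
     (auto simp: coeff_pCons split: nat.splits)

lemma coeff_basis_poly:
  "i > k \<Longrightarrow> Polynomial.coeff (basis_poly k) i = 0"
  "Polynomial.coeff (basis_poly k) k = 1"
  using coeff_chebyshev by (auto simp: basis_poly_def)

lemma poly_chebyshev: "poly (of_int_poly (chebyshev k)) (bcos n m) = bcos n (m * k)"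
proof (induction k rule: chebyshev.induct)
  case (3 k)
  thus ?case using bcos_mult[of m "m * Suc k" n]
    by (simp add: hom_distribs algebra_simps)
qed simp_all

lemma poly_basis_poly: "poly (of_int_poly (basis_poly k)) (bcos n m) = cos_basis n m k"
  by (simp add: basis_poly_def cos_basis_def poly_chebyshev)

lemma poly_over_of_int_poly: "\<int> \<subseteq> K \<Longrightarrow> poly_over K (of_int_poly p)"
  unfolding poly_over_def by (auto simp: coeff_map_poly)

lemma cos_basis_in_adjoin:
  assumes "\<int> \<subseteq> K"
  shows "cos_basis n 1 k \<in> adjoin K (bcos n 1)"
  using adjoinI[OF poly_over_of_int_poly[OF assms, of "basis_poly k"], of "bcos n 1"]
  unfolding poly_basis_poly .

lemma adjoin_bcos_eq:
  assumes "is_real_subring K" "\<int> \<subseteq> K"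
  shows "adjoin K (bcos n 1) = {\<Sum>k<2 ^ n. c k * cos_basis n 1 k | c. \<forall>k. c k \<in> K}"
proof (intro equalityI subsetI)
  fix x assume "x \<in> adjoin K (bcos n 1)"
  then obtain p where "poly_over K p" "x = poly p (bcos n 1)" unfolding adjoin_def by blast
  then obtain c where "\<forall>k. c k \<in> K" "x = (\<Sum>k<2 ^ n. c k * cos_basis n 1 k)"
    using cos_comb_poly[OF assms(1), of p n] unfolding cos_comb_def by (metis odd_one)
  thus "x \<in> {\<Sum>k<2 ^ n. c k * cos_basis n 1 k | c. \<forall>k. c k \<in> K}" by blast
next
  fix x assume "x \<in> {\<Sum>k<2 ^ n. c k * cos_basis n 1 k | c. \<forall>k. c k \<in> K}"
  then obtain c where "\<forall>k. c k \<in> K" "x = (\<Sum>k<2 ^ n. c k * cos_basis n 1 k)" by blast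
  thus "x \<in> adjoin K (bcos n 1)"
    using cos_basis_in_adjoin[OF assms(2)] adjoin_base[OF assms(1)]
      is_real_subringD(7)[OF is_real_subring_adjoin[OF assms(1)]]
    by (auto intro!: is_real_subring_sum[OF is_real_subring_adjoin[OF assms(1)]])
qed

section \<open>Ramification at 2 and the ring of integers\<close>

lemma is_real_subring_algebraic_int: "is_real_subring {x. algebraic_int x}"
  by (auto simp: is_real_subring_def algebraic_int_diff algebraic_int_mult)

lemma algebraic_int_if_square:
  assumes "algebraic_int ((x :: real)\<^sup>2)"
  shows "algebraic_int x"
  using algebraic_int_sqrt[OF assms] by simp

text \<open>By the half-angle formula each generator squares to 2 plus the preceding one, so
  integrality ascends through square roots.\<close>

lemma algebraic_int_bcos_1: "algebraic_int (bcos n 1)"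
proof (induction n)
  case 0
  have "bcos 0 1 = 0" using bcos_eq_0_iff[of 0 1] by simp
  thus ?case by simp
next
  case (Suc n)
  have "(bcos (Suc n) 1)\<^sup>2 = 2 + bcos n 1"
    using bcos_square[of "Suc n" 1] bcos_Suc_double[of n 1] by simp
  moreover have "algebraic_int (2 + bcos n 1)" using Suc by (intro algebraic_int_add) auto
  ultimately show ?case by (metis algebraic_int_if_square)
qed

lemma algebraic_int_adjoin_Ints:
  assumes "algebraic_int t" "x \<in> adjoin \<int> t"
  shows "algebraic_int x"
proof -
  have "\<int> \<subseteq> {x :: real. algebraic_int x}" using int_imp_algebraic_int by blast
  hence "adjoin \<int> t \<subseteq> {x. algebraic_int x}"
    using assms(1) by (intro adjoin_subset is_real_subring_Ints is_real_subring_algebraic_int) auto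
  thus ?thesis using assms(2) by blast
qed

lemma algebraic_int_bcos: "algebraic_int (bcos n k)"
  using algebraic_int_adjoin_Ints[OF algebraic_int_bcos_1
      adjoinI[OF poly_over_of_int_poly[OF order_refl, of "chebyshev k"]], of n]
  unfolding poly_chebyshev by simp

lemma algebraic_int_cos_basis: "algebraic_int (cos_basis n m k)"
  by (simp add: cos_basis_def algebraic_int_bcos)

text \<open>Iterated angle doubling as a monic polynomial in \<open>t\<close>;
  \<open>halving j\<close> vanishes at the square of the generator
  \<open>bcos (Suc j) 1\<close>.\<close>

fun halving :: "nat \<Rightarrow> real \<Rightarrow> real" where
  "halving 0 t = t - 2"
| "halving (Suc j) t = (halving j t)\<^sup>2 - 2"

lemma halving_bcos: "halving j ((bcos n k)\<^sup>2) = bcos n (2 ^ (j + 1) * k)"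
  by (induction j) (simp_all add: bcos_square mult.assoc)

text \<open>The shape of an Eisenstein polynomial at 2: all lower terms are divisible by 2 and the
  constant term is \<open>2 * s\<close> for a sign \<open>s\<close>. Squaring and subtracting 2
  preserves it, since \<open>4 - 2 = 2\<close>.\<close>

lemma halving_Eisenstein:
  "\<exists>s r. (s = 1 \<or> s = - 1) \<and> r \<in> adjoin \<int> t \<and> halving j t = t ^ (2 ^ j) + 2 * s * (1 + t * r)"
proof (induction j)
  case 0
  show ?case using is_real_subringD(1)[OF is_real_subring_adjoin[OF is_real_subring_Ints], of t]
    by (intro exI[of _ "- 1"] exI[of _ 0]) simp
next
  case (Suc j)
  note R = is_real_subringD[OF is_real_subring_adjoin[OF is_real_subring_Ints, of t]]
  then obtain s r where sr: "s = 1 \<or> s = - 1" "r \<in> adjoin \<int> t"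
    "halving j t = t ^ (2 ^ j) + 2 * s * (1 + t * r)" using Suc by blast
  define M where "M = (2 :: nat) ^ j"
  obtain M' where M': "M = Suc M'" by (metis M_def not0_implies_Suc power_not_zero zero_neq_numeral)
  \<comment> \<open>The expanded square without its top power and its constant 2, divided by
    \<open>2 * t\<close>; \<open>M = Suc M'\<close> supplies the factor \<open>t\<close> of
    \<open>t ^ M\<close>.\<close>
  define r' where "r' = 2 * s * t ^ M' * (1 + t * r) + 2 * 2 * r + 2 * t * r * r"
  have t: "t \<in> adjoin \<int> t" by (rule adjoin_gen[OF is_real_subring_Ints])
  have s: "s \<in> adjoin \<int> t" using sr(1) R(2,4) by (auto simp: R)
  have "r' \<in> adjoin \<int> t" unfolding r'_def
    using s t sr(2) by (intro R(5,7,8,3,2)) 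
  moreover have "halving (Suc j) t = t ^ (2 ^ Suc j) + 2 * 1 * (1 + t * r')"
  proof -
    have s2: "s * s = 1" using sr(1) by auto
    have "halving (Suc j) t = (t * t ^ M')\<^sup>2 + 4 * s * (t * t ^ M') * (1 + t * r) + 4 * (s * s) * (1 + t * r)\<^sup>2 - 2"
      using sr(3) by (simp add: M_def[symmetric] M' power2_eq_square algebra_simps)
    also have "\<dots> = (t * t ^ M')\<^sup>2 + 2 * 1 * (1 + t * r')"
      unfolding s2 r'_def by (simp add: power2_eq_square algebra_simps)
    also have "(t * t ^ M')\<^sup>2 = t ^ (2 ^ Suc j)"
      by (simp add: power_even_eq M'[unfolded M_def] mult_2_right power_add power2_eq_square)
    finally show ?thesis .
  qed
  ultimately show ?case by blast
qed

text \<open>As \<open>halving n t = 0\<close>, the Eisenstein shape reads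
  \<open>t ^ (2 ^ n) = 2 * w\<close> with \<open>w\<close> congruent to a sign modulo
  \<open>t\<close>. Such a \<open>w\<close> is invertible in \<open>adjoin \<int> t\<close>, so 2 is
  a unit times a power of \<open>t\<close>.\<close>

lemma two_ramified:
  fixes n :: nat
  defines "t \<equiv> (bcos (Suc n) 1)\<^sup>2"
  obtains u w where "u \<in> adjoin \<int> t" "w \<in> adjoin \<int> t" "w * u = 1" "t ^ (2 ^ n) * u = 2"
proof -
  note R = is_real_subringD[OF is_real_subring_adjoin[OF is_real_subring_Ints, of t]]
  obtain s r where sr: "s = 1 \<or> s = - 1" "r \<in> adjoin \<int> t"
    "halving n t = t ^ (2 ^ n) + 2 * s * (1 + t * r)" using halving_Eisenstein by blast
  have "bcos (Suc n) (2 ^ (n + 1) * 1) = 0" using bcos_eq_0_iff[of "Suc n" "2 ^ (n + 1)"]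
    by (auto intro!: exI[of _ 1])
  hence "halving n t = 0" unfolding t_def halving_bcos .
  define M where "M = (2 :: nat) ^ n"
  define h w where "h = - r" and "w = - s * (1 + t * r)"
  have tM: "t ^ M = 2 * w" using sr(3) \<open>halving n t = 0\<close> by (simp add: M_def w_def)
  \<comment> \<open>The inverse of \<open>w = - s * (1 - t * h)\<close>: the geometric series leaves
    the error \<open>t ^ M * h ^ M = 2 * w * h ^ M\<close>, itself a multiple of \<open>w\<close>,
    which the second term corrects.\<close>
  define u where "u = - s * ((\<Sum>i<M. (t * h) ^ i) - 2 * s * h ^ M)"
  have t: "t \<in> adjoin \<int> t" by (rule adjoin_gen[OF is_real_subring_Ints])
  have s: "s \<in> adjoin \<int> t" using sr(1) R(2,4) by auto
  have h: "h \<in> adjoin \<int> t" using sr(2) R(4) h_def by simp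
  have 1: "w \<in> adjoin \<int> t" unfolding w_def using s t sr(2) by (intro R)
  have 2: "u \<in> adjoin \<int> t" unfolding u_def using s t h
    by (intro R is_real_subring_sum[OF is_real_subring_adjoin[OF is_real_subring_Ints]])
  have s2: "s * s = 1" using sr(1) by auto
  have "w * u = (s * s) * ((1 - t * h) * (\<Sum>i<M. (t * h) ^ i) - 2 * s * (1 - t * h) * h ^ M)"
    by (simp add: w_def u_def h_def algebra_simps)
  also have "(1 - t * h) * (\<Sum>i<M. (t * h) ^ i) = 1 - t ^ M * h ^ M"
    by (subst one_diff_power_eq[symmetric]) (simp add: power_mult_distrib)
  also have "1 - t ^ M * h ^ M - 2 * s * (1 - t * h) * h ^ M = 1"
    unfolding tM by (simp add: w_def h_def algebra_simps)
  finally have 3: "w * u = 1" using s2 by simp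
  moreover have "t ^ M * u = 2" using tM 3 by simp
  ultimately show thesis using that 1 2 unfolding M_def by blast
qed

text \<open>By total ramification an integral inverse would make 2 a unit, but the rational number
  1/2 is not an algebraic integer.\<close>

lemma bcos_1_not_unit:
  assumes "algebraic_int y"
  shows "bcos (Suc n) 1 * y \<noteq> 1"
proof
  assume eq: "bcos (Suc n) 1 * y = 1"
  define t where "t = (bcos (Suc n) 1)\<^sup>2"
  obtain u w where uw: "u \<in> adjoin \<int> t" "w \<in> adjoin \<int> t" "w * u = 1" "t ^ (2 ^ n) * u = 2"
    unfolding t_def by (rule two_ramified)
  have "algebraic_int t" unfolding t_def by (rule algebraic_int_power[OF algebraic_int_bcos_1])
  hence w: "algebraic_int w" using uw(2) algebraic_int_adjoin_Ints by blast
  have "t * y\<^sup>2 = 1" unfolding t_def using eq by (simp flip: power_mult_distrib)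
  hence "t ^ (2 ^ n) * (y\<^sup>2) ^ (2 ^ n) = 1" by (simp flip: power_mult_distrib)
  hence "2 * ((y\<^sup>2) ^ (2 ^ n) * w) = t ^ (2 ^ n) * (y\<^sup>2) ^ (2 ^ n) * (w * u)"
    by (subst uw(4)[symmetric]) (simp add: mult_ac)
  also have "\<dots> = 1" using \<open>t ^ (2 ^ n) * (y\<^sup>2) ^ (2 ^ n) = 1\<close> uw(3) by simp
  finally have half: "(y\<^sup>2) ^ (2 ^ n) * w = 1 / 2" by simp
  have "algebraic_int ((y\<^sup>2) ^ (2 ^ n) * w)"
    using w assms by (intro algebraic_int_mult algebraic_int_power)
  hence "(1 / 2 :: real) \<in> \<int>" unfolding half by (rule rational_algebraic_int_is_int) auto
  then obtain i :: int where "(1 / 2 :: real) = of_int i" by (auto elim: Ints_cases)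
  hence "real_of_int (2 * i) = 1" by simp
  hence "2 * i = 1" by (simp only: of_int_eq_1_iff)
  thus False by presburger
qed

section \<open>Saturation at 2 and independence of the cosine basis\<close>

lemma sum_lessThan_add: "(\<Sum>j<a + b. f j) = (\<Sum>j<a. f j) + (\<Sum>j<b. f (a + j))"
  for f :: "nat \<Rightarrow> 'a :: comm_monoid_add"
  by (induction b) (simp_all add: add.assoc)

text \<open>With \<open>l = bcos n 1\<close>, the number 2 is \<open>l ^ (2 ^ n)\<close> times a
  unit. Once all coefficients below \<open>k\<close> are even, cancelling \<open>l ^ k\<close> shows
  that \<open>l\<close> divides \<open>c k\<close>; as \<open>l\<close> also divides 2, an odd
  \<open>c k\<close> would make \<open>l\<close> a unit.\<close>

lemma even_power_coeffs:
  fixes c :: "nat \<Rightarrow> int"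
  assumes n: "n = Suc n'" and x: "algebraic_int x"
    and eq: "(\<Sum>k<2 ^ n. of_int (c k) * bcos n 1 ^ k) = 2 * x"
  shows "k < 2 ^ n \<Longrightarrow> even (c k)"
proof (induction k rule: less_induct)
  case (less k)
  define l N where "l = bcos n 1" and "N = (2 :: nat) ^ n"
  define t where "t = l\<^sup>2"
  obtain u w where uw: "u \<in> adjoin \<int> t" "w \<in> adjoin \<int> t" "w * u = 1" "t ^ (2 ^ n') * u = 2"
    unfolding t_def l_def n by (rule two_ramified)
  have l: "algebraic_int l" unfolding l_def by (rule algebraic_int_bcos_1)
  have u: "algebraic_int u"
    using uw(1) algebraic_int_adjoin_Ints algebraic_int_power[OF l, of 2] unfolding t_def by blast
  have lN: "l ^ N * u = 2" using uw(4) unfolding t_def N_def n by (simp add: power_mult)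
  \<comment> \<open>\<open>A\<close> is half of the part already known to be even, \<open>B\<close>
    the part above \<open>k\<close> with \<open>l ^ Suc k\<close> taken out.\<close>
  define A where "A = (\<Sum>j<k. of_int (c j div 2) * l ^ j)"
  define B where "B = (\<Sum>j<N - Suc k. of_int (c (Suc k + j)) * l ^ j)"
  have A: "algebraic_int A" and B: "algebraic_int B" unfolding A_def B_def
    by (intro algebraic_int_sum algebraic_int_mult algebraic_int_power l algebraic_int_of_int)+
  have k: "k < N" using less.prems by (simp add: N_def)
  have "2 * x = (\<Sum>j<Suc k + (N - Suc k). of_int (c j) * l ^ j)"
    using eq k by (simp add: l_def N_def)
  also have "\<dots> = (\<Sum>j<Suc k. of_int (c j) * l ^ j) + (\<Sum>j<N - Suc k. of_int (c (Suc k + j)) * l ^ (Suc k + j))"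
    by (rule sum_lessThan_add)
  also have "(\<Sum>j<Suc k. of_int (c j) * l ^ j) = 2 * A + of_int (c k) * l ^ k"
  proof -
    have "real_of_int (c j) = 2 * of_int (c j div 2)" if "j < k" for j
    proof -
      have "c j = 2 * (c j div 2)" using less.IH[OF that] k that by (simp add: N_def)
      thus ?thesis by (metis of_int_mult of_int_numeral)
    qed
    thus ?thesis by (simp add: A_def sum_distrib_left mult.assoc)
  qed
  also have "(\<Sum>j<N - Suc k. of_int (c (Suc k + j)) * l ^ (Suc k + j)) = l ^ k * (l * B)"
    by (simp add: B_def sum_distrib_left power_add mult_ac)
  finally have e1: "2 * (x - A) = l ^ k * (of_int (c k) + l * B)" by (simp add: algebra_simps)
  have "l ^ N = l ^ k * (l * l ^ (N - Suc k))"
    using k by (simp flip: power_add power_Suc)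
  hence e2: "2 = l ^ k * (l * l ^ (N - Suc k) * u)" using lN by simp
  have "l ^ k * (of_int (c k) + l * B) = l ^ k * (l * l ^ (N - Suc k) * u * (x - A))"
    unfolding e1[symmetric] by (subst e2) (simp only: mult.assoc)
  moreover have "l \<noteq> 0" using lN k by (auto simp: power_0_left)
  hence "l ^ k \<noteq> 0" by simp
  ultimately have "of_int (c k) + l * B = l * l ^ (N - Suc k) * u * (x - A)"
    by (metis mult_left_cancel)
  hence ck: "of_int (c k) = l * (l ^ (N - Suc k) * u * (x - A) - B)"
    by (simp add: algebra_simps)
  show "even (c k)"
  proof (rule ccontr)
    assume "odd (c k)"
    then obtain q where "c k = 2 * q + 1" by (elim oddE)
    hence "1 = of_int (c k) - 2 * real_of_int q" by simp
    also have "\<dots> = l * (l ^ (N - Suc k) * u * (x - A) - B - l ^ (N - 1) * u * of_int q)"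
    proof -
      have "2 = l * (l ^ (N - 1) * u)" using lN k by (cases N) auto
      thus ?thesis unfolding ck by (simp add: algebra_simps)
    qed
    finally have "bcos n 1 * (l ^ (N - Suc k) * u * (x - A) - B - l ^ (N - 1) * u * of_int q) = 1"
      by (simp add: l_def)
    moreover have "algebraic_int (l ^ (N - Suc k) * u * (x - A) - B - l ^ (N - 1) * u * of_int q)"
      by (intro algebraic_int_diff algebraic_int_mult algebraic_int_power l u x A B algebraic_int_of_int)
    ultimately show False using bcos_1_not_unit unfolding n by blast
  qed
qed

text \<open>The polynomials are monic of increasing degree, so the last \<open>c k\<close> is itself
  a coefficient of the sum; it is even and its term can be removed.\<close>

lemma even_triangular_coeffs:
  fixes c :: "nat \<Rightarrow> int"
  assumes "\<And>i. even (Polynomial.coeff (\<Sum>k<N. Polynomial.smult (c k) (basis_poly k)) i)" and "k < N"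
  shows "even (c k)"
  using assms
proof (induction N arbitrary: k)
  case (Suc N)
  have "Polynomial.coeff (\<Sum>k<N. Polynomial.smult (c k) (basis_poly k)) N = 0"
    by (simp add: coeff_sum coeff_basis_poly)
  hence cN: "even (c N)" using Suc.prems(1)[of N] by (simp add: coeff_basis_poly)
  have "even (Polynomial.coeff (\<Sum>k<N. Polynomial.smult (c k) (basis_poly k)) i)" for i
    using Suc.prems(1)[of i] cN by simp
  thus ?case using Suc.IH Suc.prems(2) cN less_Suc_eq by metis
qed simp

text \<open>The unitriangular change to powers of \<open>bcos n 1\<close> reduces this to
  \<open>even_power_coeffs\<close>. It says that \<open>adjoin \<int> (bcos n 1)\<close> is
  saturated at 2, and it drives both independence and the determination of the ring of
  integers.\<close>

lemma even_cos_coeffs: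
  fixes c :: "nat \<Rightarrow> int"
  assumes n: "n > 0" and x: "algebraic_int x"
    and eq: "(\<Sum>k<2 ^ n. of_int (c k) * cos_basis n 1 k) = 2 * x" and "k < 2 ^ n"
  shows "even (c k)"
proof -
  define p where "p = (\<Sum>k<2 ^ n. Polynomial.smult (c k) (basis_poly k))"
  have deg: "Polynomial.coeff p i = 0" if "i \<ge> 2 ^ n" for i
    using that by (simp add: p_def coeff_sum coeff_basis_poly)
  have "2 * x = poly (of_int_poly p) (bcos n 1)"
    unfolding p_def eq[symmetric] by (simp add: hom_distribs poly_sum poly_basis_poly)
  also have "\<dots> = (\<Sum>k<2 ^ n. of_int (Polynomial.coeff p k) * bcos n 1 ^ k)"
  proof -
    have "poly q y = (\<Sum>k<M. Polynomial.coeff q k * y ^ k)"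
      if "\<And>i. i \<ge> M \<Longrightarrow> Polynomial.coeff q i = 0" for q :: "real poly" and M y
    proof -
      have "(\<Sum>k<M. Polynomial.coeff q k * y ^ k) = (\<Sum>k\<le>Polynomial.degree q. Polynomial.coeff q k * y ^ k)"
        by (rule sum.mono_neutral_cong) (use that in \<open>auto simp: coeff_eq_0 not_le not_less\<close>)
      thus ?thesis by (simp add: poly_altdef)
    qed
    from this[of "2 ^ n" "of_int_poly p"] show ?thesis using deg by (simp add: coeff_map_poly)
  qed
  finally have eq': "(\<Sum>k<2 ^ n. of_int (Polynomial.coeff p k) * bcos n 1 ^ k) = 2 * x" by simp
  obtain n' where n': "n = Suc n'" using n gr0_implies_Suc by blast
  have "even (Polynomial.coeff p i)" for i
    using even_power_coeffs[OF n' x eq'] deg by (cases "i < 2 ^ n") auto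
  thus ?thesis using even_triangular_coeffs[where N="2 ^ n" and c=c] assms(4) unfolding p_def by blast
qed

text \<open>Descent at 2: \<open>even_cos_coeffs\<close> with \<open>x = 0\<close> applies again to
  the halved coefficients, so every power of 2 divides each of them.\<close>

lemma cos_basis_independent_Ints:
  fixes c :: "nat \<Rightarrow> int"
  assumes n: "n > 0" and eq: "(\<Sum>k<2 ^ n. of_int (c k) * cos_basis n 1 k) = 0" and k: "k < 2 ^ n"
  shows "c k = 0"
proof -
  have "2 ^ s dvd c k" for s
    using eq k
  proof (induction s arbitrary: c)
    case (Suc s)
    have ev: "even (c j)" if "j < 2 ^ n" for j
      using even_cos_coeffs[OF n algebraic_int_0, of c] Suc.prems that by simp
    have "2 * (\<Sum>k<2 ^ n. of_int (c k div 2) * cos_basis n 1 k) = (\<Sum>k<2 ^ n. of_int (c k) * cos_basis n 1 k)"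
      unfolding sum_distrib_left using ev
      by (intro sum.cong refl) (simp add: real_of_int_div flip: mult.assoc)
    hence "2 ^ s dvd c k div 2" using Suc by simp
    hence "2 * 2 ^ s dvd 2 * (c k div 2)" by (rule mult_dvd_mono[OF dvd_refl])
    thus ?case using ev[OF k] by simp
  qed simp
  moreover have "\<not> 2 ^ nat \<bar>c k\<bar> dvd c k" if "c k \<noteq> 0"
  proof
    assume "2 ^ nat \<bar>c k\<bar> dvd c k"
    hence "2 ^ nat \<bar>c k\<bar> \<le> \<bar>c k\<bar>" using that by (metis dvd_imp_le_int abs_of_nonneg zero_le_numeral zero_le_power)
    moreover have "int (nat \<bar>c k\<bar>) < 2 ^ nat \<bar>c k\<bar>" by (metis less_exp of_nat_less_iff of_nat_numeral of_nat_power)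
    ultimately show False by simp
  qed
  ultimately show ?thesis by blast
qed

lemma common_denominator:
  fixes c :: "nat \<Rightarrow> real"
  assumes "\<And>k. k < N \<Longrightarrow> c k \<in> \<rat>"
  obtains q :: int where "q > 0" "\<And>k. k < N \<Longrightarrow> of_int q * c k \<in> \<int>"
proof -
  from assms have "\<exists>q::int. q > 0 \<and> (\<forall>k<N. of_int q * c k \<in> \<int>)"
  proof (induction N)
    case (Suc N)
    then obtain q :: int where q: "q > 0" "\<forall>k<N. of_int q * c k \<in> \<int>" by (metis less_SucI)
    obtain a b :: int where ab: "b > 0" "c N = of_int a / of_int b"
      using Suc.prems[of N] by (auto elim: Rats_cases')
    have "of_int (q * b) * c k \<in> \<int>" if "k < Suc N" for k
    proof (cases "k = N")
      case True
      hence "of_int (q * b) * c k = of_int (q * a)" using ab by simp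
      thus ?thesis by (metis Ints_of_int)
    next
      case False
      hence "of_int b * (of_int q * c k) \<in> \<int>" using that q(2)
        by (auto intro!: Ints_mult[of "of_int b" "of_int q * c k"])
      thus ?thesis by (simp add: mult_ac)
    qed
    thus ?case using q ab by (intro exI[of _ "q * b"]) auto
  qed (auto intro: exI[of _ 1])
  thus thesis using that by blast
qed

lemma cos_basis_independent:
  assumes n: "n > 0" and c: "\<And>k. k < 2 ^ n \<Longrightarrow> c k \<in> \<rat>"
    and eq: "(\<Sum>k<2 ^ n. c k * cos_basis n 1 k) = 0" and k: "k < 2 ^ n"
  shows "c k = 0"
proof -
  obtain q :: int where q: "q > 0" "\<And>k. k < 2 ^ n \<Longrightarrow> of_int q * c k \<in> \<int>"
    using common_denominator[of "2 ^ n" c] c by blast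
  define d where "d k = \<lfloor>of_int q * c k\<rfloor>" for k
  have d: "of_int (d k) = of_int q * c k" if "k < 2 ^ n" for k
    using q(2)[OF that] by (simp add: d_def)
  have "(\<Sum>k<2 ^ n. of_int (d k) * cos_basis n 1 k) = of_int q * (\<Sum>k<2 ^ n. c k * cos_basis n 1 k)"
    using d by (simp add: sum_distrib_left mult.assoc)
  hence "d k = 0" using cos_basis_independent_Ints[OF n _ k] eq by simp
  thus ?thesis using d[OF k] q(1) by simp
qed

text \<open>The values at all \<open>bcos n m\<close> share one coefficient vector, and independence
  forces it to vanish. Hence sending \<open>bcos n 1\<close> to \<open>bcos n m\<close> respects
  rational relations and acts as a Galois conjugation.\<close>

lemma poly_conjugate_eq_0:
  assumes "n > 0" "poly_over \<rat> p" "poly p (bcos n 1) = 0" "odd m"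
  shows "poly p (bcos n m) = 0"
proof -
  obtain c where c: "\<forall>k. c k \<in> \<rat>" "\<forall>m. odd m \<longrightarrow> poly p (bcos n m) = (\<Sum>k<2 ^ n. c k * cos_basis n m k)"
    using cos_comb_poly[OF is_real_subring_Rats assms(2)] unfolding cos_comb_def by blast
  hence "(\<Sum>k<2 ^ n. c k * cos_basis n 1 k) = 0" using assms(3) by simp
  hence "\<forall>k<2 ^ n. c k = 0" using cos_basis_independent[OF assms(1)] c(1) by blast
  thus ?thesis using c(2) assms(4) by simp
qed

lemma poly_conjugate_eq:
  assumes "n > 0" "poly_over \<rat> p" "poly_over \<rat> q" "poly p (bcos n 1) = poly q (bcos n 1)" "odd m"
  shows "poly p (bcos n m) = poly q (bcos n m)"
  using poly_conjugate_eq_0[OF assms(1) poly_over_diff[OF is_real_subring_Rats assms(2,3)] _ assms(5)]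
    assms(4) by simp

lemma algebraic_int_conjugate:
  assumes "n > 0" "poly_over \<rat> q" "algebraic_int (poly q (bcos n 1))" "odd m"
  shows "algebraic_int (poly q (bcos n m))"
proof -
  obtain p where p: "Polynomial.lead_coeff p = 1" "\<forall>i. Polynomial.coeff p i \<in> \<int>" "poly p (poly q (bcos n 1)) = 0"
    using assms(3) by (auto elim: algebraic_int.cases)
  have "poly_over \<rat> (p \<circ>\<^sub>p q)"
    using p(2) by (intro poly_over_pcompose is_real_subring_Rats assms(2)) (use Ints_subset_Rats in \<open>auto simp: poly_over_def\<close>)
  hence "poly p (poly q (bcos n m)) = 0"
    using poly_conjugate_eq_0[OF assms(1) _ _ assms(4), of "p \<circ>\<^sub>p q"] p(3) by (simp add: poly_pcompose)
  thus ?thesis using p(1,2) by (rule_tac algebraic_int.intros)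
qed

lemma adjoin_Ints_if_double:
  assumes n: "n > 0" and y: "algebraic_int y" and "2 * y \<in> adjoin \<int> (bcos n 1)"
  shows "y \<in> adjoin \<int> (bcos n 1)"
proof -
  obtain c where c: "2 * y = (\<Sum>k<2 ^ n. c k * cos_basis n 1 k)" "\<forall>k. c k \<in> \<int>"
    using assms(3) unfolding adjoin_bcos_eq[OF is_real_subring_Ints order_refl] by blast
  define d where "d k = \<lfloor>c k\<rfloor>" for k
  have d: "of_int (d k) = c k" for k using c(2) by (simp add: d_def)
  have eq: "(\<Sum>k<2 ^ n. of_int (d k) * cos_basis n 1 k) = 2 * y" using c(1) d by simp
  have ev: "even (d k)" if "k < 2 ^ n" for k by (rule even_cos_coeffs[OF n y eq that])
  have "2 * (\<Sum>k<2 ^ n. of_int (d k div 2) * cos_basis n 1 k) = 2 * y"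
    unfolding eq[symmetric] sum_distrib_left using ev
    by (intro sum.cong refl) (simp add: real_of_int_div flip: mult.assoc)
  hence "y = (\<Sum>k<2 ^ n. of_int (d k div 2) * cos_basis n 1 k)" by simp
  thus ?thesis unfolding adjoin_bcos_eq[OF is_real_subring_Ints order_refl]
    by (intro CollectI exI[of _ "\<lambda>k. of_int (d k div 2)"]) simp
qed

text \<open>The trace pairing with a basis element gives \<open>c k\<close> times
  \<open>2 ^ n\<close> or \<open>2 * 2 ^ n\<close>, a rational algebraic integer and so an integer.
  The powers of 2 left in the denominators are removed one by one through saturation at 2.\<close>

lemma adjoin_Ints_if_algebraic_int:
  assumes n: "n > 0" and x: "x \<in> adjoin \<rat> (bcos n 1)" "algebraic_int x"
  shows "x \<in> adjoin \<int> (bcos n 1)"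
proof -
  obtain q where q: "poly_over \<rat> q" "x = poly q (bcos n 1)" using x(1) unfolding adjoin_def by blast
  obtain c where c: "\<forall>k. c k \<in> \<rat>" "\<forall>m. odd m \<longrightarrow> poly q (bcos n m) = (\<Sum>k<2 ^ n. c k * cos_basis n m k)"
    using cos_comb_poly[OF is_real_subring_Rats q(1)] unfolding cos_comb_def by blast
  have int: "2 * 2 ^ n * c k \<in> \<int>" if k: "k < 2 ^ n" for k
  proof -
    have "(\<Sum>i<2 ^ n. poly q (bcos n (2 * i + 1)) * cos_basis n (2 * i + 1) k) =
      (\<Sum>j<2 ^ n. c j * (if j = k then 1 else 0) * (if j = 0 then 2 ^ n else 2 * 2 ^ n))"
      by (rule cos_basis_inner) (use c(2) k in \<open>auto simp: if_distrib[of "\<lambda>x. x * _"] cong: if_cong\<close>)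
    also have "\<dots> = c k * (if k = 0 then 2 ^ n else 2 * 2 ^ n)"
    proof -
      have "(\<Sum>j<2 ^ n. c j * (if j = k then 1 else 0) * (if j = 0 then 2 ^ n else 2 * 2 ^ n)) =
        (\<Sum>j<2 ^ n. if j = k then c k * (if k = 0 then 2 ^ n else 2 * 2 ^ n) else 0)"
        by (intro sum.cong refl) auto
      thus ?thesis using k by (simp add: sum.delta)
    qed
    \<comment> \<open>The extra factor at index 0 evens out the two weights, so that
      \<open>2 * 2 ^ n\<close> is a denominator for every \<open>k\<close>.\<close>
    finally have eq: "(if k = 0 then 2 else 1) * (\<Sum>i<2 ^ n. poly q (bcos n (2 * i + 1)) * cos_basis n (2 * i + 1) k)
      = 2 * 2 ^ n * c k" by simp
    have "algebraic_int (\<Sum>i<2 ^ n. poly q (bcos n (2 * i + 1)) * cos_basis n (2 * i + 1) k)"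
      using x(2) q algebraic_int_conjugate[OF n q(1)]
      by (intro algebraic_int_sum algebraic_int_mult algebraic_int_cos_basis) auto
    hence "algebraic_int (2 * 2 ^ n * c k)" unfolding eq[symmetric]
      by (intro algebraic_int_mult) auto
    thus ?thesis using c(1) by (intro rational_algebraic_int_is_int Rats_mult) auto
  qed
  have "2 ^ (n + 1) * x = (\<Sum>k<2 ^ n. (if k < 2 ^ n then 2 * 2 ^ n * c k else 0) * cos_basis n 1 k)"
    using q(2) c(2) by (simp add: sum_distrib_left mult.assoc)
  also have "\<dots> \<in> adjoin \<int> (bcos n 1)"
    unfolding adjoin_bcos_eq[OF is_real_subring_Ints order_refl] using int
    by (intro CollectI exI[of _ "\<lambda>k. if k < 2 ^ n then 2 * 2 ^ n * c k else 0"]) auto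
  finally have "2 ^ (n + 1) * x \<in> adjoin \<int> (bcos n 1)" .
  moreover have "2 ^ s * x \<in> adjoin \<int> (bcos n 1) \<Longrightarrow> x \<in> adjoin \<int> (bcos n 1)" for s
  proof (induction s)
    case (Suc s)
    have "algebraic_int (2 ^ s * x)" by (intro algebraic_int_mult algebraic_int_power x(2)) auto
    thus ?case using adjoin_Ints_if_double[OF n] Suc by (simp add: mult.assoc)
  qed simp
  ultimately show ?thesis by blast
qed

section \<open>Norm and trace\<close>

lemma adjoin_bcos_square:
  assumes K: "is_real_subring K"
  shows "adjoin K ((bcos (Suc n) 1)\<^sup>2) = adjoin K (bcos n 1)"
proof -
  have sq: "(bcos (Suc n) 1)\<^sup>2 = 2 + bcos n 1"
    using bcos_square[of "Suc n" 1] bcos_Suc_double[of n 1] by simp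
  note R1 = is_real_subring_adjoin[OF K, of "bcos n 1"]
  note R2 = is_real_subring_adjoin[OF K, of "(bcos (Suc n) 1)\<^sup>2"]
  have "(bcos (Suc n) 1)\<^sup>2 \<in> adjoin K (bcos n 1)"
    unfolding sq using is_real_subringD(3,5)[OF R1] adjoin_gen[OF K] by blast
  moreover have "(bcos (Suc n) 1)\<^sup>2 - 2 \<in> adjoin K ((bcos (Suc n) 1)\<^sup>2)"
    using is_real_subringD(3,6)[OF R2] adjoin_gen[OF K] by blast
  hence "bcos n 1 \<in> adjoin K ((bcos (Suc n) 1)\<^sup>2)" unfolding sq by simp
  ultimately show ?thesis
    using adjoin_subset[OF K R1] adjoin_subset[OF K R2] adjoin_base[OF K]
    by (meson subset_antisym subsetI)
qed

lemma bcos_1_nonzero: "n > 0 \<Longrightarrow> bcos n 1 \<noteq> 0"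
  using bcos_eq_0_iff[of n 1] by (cases n) auto

text \<open>The multiplier \<open>2 ^ (n + 1) - 1\<close> sends \<open>\<zeta>\<close> to
  \<open>- 1 / \<zeta>\<close>. For \<open>n > 0\<close> it gives the nontrivial automorphism over
  the subfield of index 2: the generator changes sign and even indices are fixed.\<close>

lemma bcos_neg_conjugate: "bcos n ((2 ^ (n + 1) - 1) * k) = (- 1) ^ k * bcos n k"
proof -
  have "(2 ^ (n + 1) - 1) * k = k * 2 ^ (n + 1) - k" by (simp add: mult.commute[of _ k] diff_mult_distrib2)
  thus ?thesis using bcos_reflect[of k k n] by simp
qed

lemma odd_neg_conjugate: "odd (2 ^ (n + 1) - 1 :: nat)"
  by simp

text \<open>Since \<open>y\<close> and \<open>z\<close> are polynomials in the square of the
  generator, the sign change also yields \<open>y - bcos n 1 * z = 0\<close>. Thus 1 and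
  \<open>bcos n 1\<close> are independent over the smaller field.\<close>

lemma square_split_conjugate:
  assumes n: "n > 0" and yz: "y \<in> adjoin \<rat> ((bcos n 1)\<^sup>2)" "z \<in> adjoin \<rat> ((bcos n 1)\<^sup>2)"
    and eq: "y + bcos n 1 * z = 0"
  shows "y = 0 \<and> z = 0"
proof -
  define l where "l = bcos n 1"
  obtain p q where p: "poly_over \<rat> p" "y = poly p (l\<^sup>2)" and q: "poly_over \<rat> q" "z = poly q (l\<^sup>2)"
    using yz unfolding adjoin_def l_def by blast
  define v where "v = [:0, 1 :: real:]"
  have v: "poly_over \<rat> v" by (simp add: v_def poly_over_pCons poly_over_0[OF is_real_subring_Rats])
  define S where "S = p \<circ>\<^sub>p (v * v) + v * (q \<circ>\<^sub>p (v * v))"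
  have S: "poly_over \<rat> S" unfolding S_def
    by (intro poly_over_add poly_over_mult poly_over_pcompose is_real_subring_Rats p(1) q(1) v)
  have S_eval: "poly S x = poly p (x\<^sup>2) + x * poly q (x\<^sup>2)" for x
    by (simp add: S_def v_def poly_pcompose power2_eq_square)
  have "poly S l = 0" using eq p(2) q(2) S_eval by (simp add: l_def)
  hence "poly S (bcos n (2 ^ (n + 1) - 1)) = 0"
    unfolding l_def by (rule poly_conjugate_eq_0[OF n S _ odd_neg_conjugate])
  hence "poly S (- l) = 0" using bcos_neg_conjugate[of n 1] by (simp add: l_def)
  hence "y - l * z = 0" using p(2) q(2) S_eval by simp
  moreover have "y + l * z = 0" using eq by (simp add: l_def)
  moreover have "l \<noteq> 0" unfolding l_def by (rule bcos_1_nonzero[OF n])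
  ultimately show ?thesis by auto
qed

text \<open>Each level is a quadratic step: \<open>y + l * z\<close> is inverted through
  \<open>y - l * z\<close>, because their product lies in the preceding field. The conjugate factor
  is nonzero by \<open>square_split_conjugate\<close>.\<close>

lemma is_real_field_adjoin_bcos: "is_real_field (adjoin \<rat> (bcos n 1))"
proof (induction n)
  case 0
  have "bcos 0 1 = 0" using bcos_eq_0_iff[of 0 1] by simp
  moreover have "adjoin \<rat> 0 = \<rat>"
    using adjoin_subset[OF is_real_subring_Rats is_real_subring_Rats, of 0]
      adjoin_base[OF is_real_subring_Rats] by auto
  ultimately show ?case using is_real_field_Rats by simp
next
  case (Suc n)
  define l where "l = bcos (Suc n) 1"
  note R = is_real_subring_adjoin[OF is_real_subring_Rats, of l]
  have sq: "adjoin \<rat> (l\<^sup>2) = adjoin \<rat> (bcos n 1)"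
    unfolding l_def by (rule adjoin_bcos_square[OF is_real_subring_Rats])
  have sub: "adjoin \<rat> (l\<^sup>2) \<subseteq> adjoin \<rat> l"
    using adjoin_subset[OF is_real_subring_Rats R] adjoin_base[OF is_real_subring_Rats]
      adjoin_gen[OF is_real_subring_Rats] is_real_subringD(8)[OF R] by (simp add: subsetI)
  have "inverse x \<in> adjoin \<rat> l" if x: "x \<in> adjoin \<rat> l" for x
  proof (cases "x = 0")
    case False
    obtain y z where yz: "y \<in> adjoin \<rat> (l\<^sup>2)" "z \<in> adjoin \<rat> (l\<^sup>2)" "x = y + l * z"
      using adjoin_square_split[OF is_real_subring_Rats x] by blast
    note F = is_real_fieldD[OF Suc[folded sq]]
    define d where "d = y * y - l\<^sup>2 * (z * z)"
    have "d \<in> adjoin \<rat> (l\<^sup>2)" unfolding d_def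
      using yz adjoin_gen[OF is_real_subring_Rats] by (intro F)
    hence inv: "inverse d \<in> adjoin \<rat> l" using F(4) sub by blast
    have d: "d = x * (y - l * z)" by (simp add: d_def yz(3) algebra_simps power2_eq_square)
    have "y - l * z \<noteq> 0"
    proof
      assume "y - l * z = 0"
      moreover have "- z \<in> adjoin \<rat> (l\<^sup>2)" using yz(2) F by blast
      ultimately have "y = 0 \<and> - z = 0"
        using square_split_conjugate[of "Suc n" y "- z"] yz(1) unfolding l_def by simp
      thus False using False yz(3) by simp
    qed
    hence "inverse x = (y - l * z) * inverse d" using False by (simp add: d field_simps)
    moreover have "y - l * z \<in> adjoin \<rat> l"
      using yz(1,2) sub adjoin_gen[OF is_real_subring_Rats] is_real_subringD(6,7)[OF R] by blast
    ultimately show ?thesis using inv is_real_subringD(7)[OF R] by simp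
  qed (use x in simp)
  thus ?case using R unfolding l_def is_real_field_def by blast
qed

lemma B_field_eq: "B_field n = adjoin \<rat> (bcos n 1)"
proof -
  define c where "c = cos (pi / 2 ^ (n + 1))"
  have bc: "bcos n 1 = 2 * c" by (simp add: bcos_def c_def)
  have K: "is_real_subring \<rat>" by (rule is_real_subring_Rats)
  note R = is_real_subring_adjoin[OF K, of "bcos n 1"]
  have "(1 / 2) * bcos n 1 \<in> adjoin \<rat> (bcos n 1)"
    by (rule is_real_subringD(7)[OF R adjoin_base[OF K] adjoin_gen[OF K]]) simp
  moreover have "(1 / 2) * bcos n 1 = c" unfolding bc by simp
  ultimately have c: "c \<in> adjoin \<rat> (bcos n 1)" by metis
  have sub1: "B_field n \<subseteq> adjoin \<rat> (bcos n 1)"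
    unfolding B_field_def c_def[symmetric]
    by (rule field.generate_field_min_subfield1[OF field_from_type_algebra])
       (use c adjoin_base[OF K] is_real_field_adjoin_bcos in \<open>auto simp: subfield_iff_is_real_field\<close>)
  have "is_real_field (B_field n)"
    unfolding B_field_def subfield_iff_is_real_field[symmetric]
    by (rule field.generate_field_is_subfield[OF field_from_type_algebra]) simp
  note F = is_real_fieldD[OF this]
  have gen: "c \<in> B_field n" "\<rat> \<subseteq> B_field n"
    unfolding B_field_def c_def by (auto intro: generate_field.incl)
  have "adjoin \<rat> (bcos n 1) \<subseteq> B_field n"
  proof (rule adjoin_subset[OF K])
    show "is_real_subring (B_field n)"
      using \<open>is_real_field (B_field n)\<close> by (simp add: is_real_field_def)
    show "bcos n 1 \<in> B_field n" unfolding bc using F(5)[OF gen(1) gen(1)] by simp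
  qed (rule gen)
  with sub1 show ?thesis by blast
qed

lemma is_real_field_B_field: "is_real_field (B_field n)"
  unfolding B_field_eq by (rule is_real_field_adjoin_bcos)

section \<open>The relative norm in a quadratic step\<close>

lemma det_2x2:
  fixes A :: "'a :: comm_ring_1 mat"
  assumes A: "A \<in> carrier_mat 2 2"
  shows "det A = A $$ (0, 0) * A $$ (1, 1) - A $$ (0, 1) * A $$ (1, 0)"
proof -
  have del: "mat_delete A i 0 \<in> carrier_mat 1 1" for i
    using A by (simp add: mat_delete_def)
  have "det A = (\<Sum>i<2. A $$ (i, 0) * cofactor A i 0)"
    by (rule laplace_expansion_column[OF A]) simp
  also have "\<dots> = A $$ (0, 0) * A $$ (1, 1) - A $$ (1, 0) * A $$ (0, 1)"
    using A by (simp add: numeral_2_eq_2 cofactor_def det_single[OF del]) (simp add: mat_delete_def)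
  finally show ?thesis by (simp add: mult.commute)
qed

lemma field_norm_B_field:
  assumes y: "y \<in> B_field n" and z: "z \<in> B_field n"
  shows "field_norm (B_field (Suc n)) (B_field n) (y + bcos (Suc n) 1 * z) = y\<^sup>2 - (bcos (Suc n) 1)\<^sup>2 * z\<^sup>2"
proof -
  define l where "l = bcos (Suc n) 1"
  define us where "us = [1, l]"
  note F = is_real_fieldD[OF is_real_field_B_field]
  have sq: "adjoin \<rat> (l\<^sup>2) = B_field n"
    unfolding l_def B_field_eq by (rule adjoin_bcos_square[OF is_real_subring_Rats])
  have l2: "l\<^sup>2 \<in> B_field n" using adjoin_gen[OF is_real_subring_Rats] sq by blast
  have l: "l \<in> B_field (Suc n)" unfolding l_def B_field_eq by (rule adjoin_gen[OF is_real_subring_Rats])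
  have sub: "B_field n \<subseteq> B_field (Suc n)"
    unfolding sq[symmetric] using F(7)[of l "Suc n" l] l adjoin_base[OF is_real_subring_Rats]
    by (intro adjoin_subset is_real_subring_Rats)
       (auto simp: B_field_eq power2_eq_square is_real_subring_adjoin is_real_subring_Rats)
  have "field_basis (B_field n) (B_field (Suc n)) us"
    unfolding field_basis_iff_sums[OF is_real_field_B_field]
  proof (intro conjI allI impI)
    fix c i assume c: "\<forall>i<length us. c i \<in> B_field n" "(\<Sum>i<length us. c i * us ! i) = 0" and i: "i < length us"
    have "c 0 \<in> B_field n" "c 1 \<in> B_field n" "c 0 + l * c 1 = 0"
      using c by (auto simp: us_def mult.commute)
    hence "c 0 = 0 \<and> c 1 = 0"
      using square_split_conjugate[of "Suc n" "c 0" "c 1"] sq by (simp add: l_def)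
    thus "c i = 0" using i by (auto simp: us_def less_Suc_eq)
  next
    show "B_field (Suc n) = {\<Sum>i<length us. c i * us ! i |c. \<forall>i<length us. c i \<in> B_field n}"
    proof (intro equalityI subsetI)
      fix x assume "x \<in> B_field (Suc n)"
      then obtain a b where ab: "a \<in> B_field n" "b \<in> B_field n" "x = a + l * b"
        using adjoin_square_split[OF is_real_subring_Rats, of x l] sq unfolding B_field_eq[of "Suc n"] l_def by metis
      thus "x \<in> {\<Sum>i<length us. c i * us ! i |c. \<forall>i<length us. c i \<in> B_field n}"
        by (intro CollectI exI[of _ "\<lambda>i. if i = 0 then a else b"]) (auto simp: us_def)
    next
      fix x assume "x \<in> {\<Sum>i<length us. c i * us ! i |c. \<forall>i<length us. c i \<in> B_field n}"
      then obtain c where "x = (\<Sum>i<length us. c i * us ! i)" "\<forall>i<length us. c i \<in> B_field n" by blast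
      hence "x = c 0 + c 1 * l" "c 0 \<in> B_field n" "c 1 \<in> B_field n"
        by (simp_all add: us_def)
      thus "x \<in> B_field (Suc n)" using F(5,7) sub l by blast
    qed
  qed
  moreover have "l\<^sup>2 * z \<in> B_field n" by (rule F(7)[OF l2 z])
  \<comment> \<open>The columns are the coordinates of \<open>y + l * z\<close> and
    \<open>l * (y + l * z)\<close> in the basis \<open>1, l\<close>.\<close>
  hence "is_mult_matrix (B_field n) us (y + l * z) (mat_of_rows_list 2 [[y, l\<^sup>2 * z], [z, y]])"
    unfolding is_mult_matrix_def us_def using y z
    by (auto simp: mat_of_rows_list_def less_Suc_eq power2_eq_square algebra_simps)
  moreover have "det (mat_of_rows_list 2 [[y, l\<^sup>2 * z], [z, y]]) = y\<^sup>2 - l\<^sup>2 * z\<^sup>2"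
    by (subst det_2x2) (auto simp: mat_of_rows_list_def power2_eq_square)
  ultimately show ?thesis
    using field_norm_eq_det[OF is_real_field_B_field] unfolding l_def by metis
qed

section \<open>The absolute trace as the sum of the conjugates\<close>

lemma sum_cos_basis_squares:
  assumes "odd m"
  shows "(\<Sum>j<2 ^ n. (cos_basis n m j)\<^sup>2 / (if j = 0 then 1 else 2)) = 2 ^ n"
proof -
  define M :: nat where "M = 2 ^ n - 1"
  have M: "2 ^ n = Suc M" by (simp add: M_def)
  define S where "S = (\<Sum>j<M. bcos n (2 * m * Suc j))"
  \<comment> \<open>Reversing the indices negates each term because \<open>m\<close> is odd. Hence
    \<open>S = - S\<close>, and the double-angle parts of the squares cancel.\<close>
  have reflect: "bcos n (2 * m * Suc (M - Suc j)) = - bcos n (2 * m * Suc j)" if j: "j < M" for j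
  proof -
    have "2 * m * Suc (M - Suc j) = m * 2 ^ (n + 1) - 2 * m * Suc j"
      using j M by (simp add: Suc_diff_Suc algebra_simps flip: diff_mult_distrib2)
    moreover have "2 * m * Suc j \<le> m * 2 ^ (n + 1)" using j M by simp
    ultimately show ?thesis using bcos_reflect[of "2 * m * Suc j" m n] assms by simp
  qed
  have "S = (\<Sum>j<M. bcos n (2 * m * Suc (M - Suc j)))"
    unfolding S_def by (rule sum.nat_diff_reindex[symmetric])
  also have "\<dots> = - S" unfolding S_def sum_negf[symmetric] using reflect by (intro sum.cong) auto
  finally have "S = 0" by simp
  have "(\<Sum>j<2 ^ n. (cos_basis n m j)\<^sup>2 / (if j = 0 then 1 else 2)) = 1 + (\<Sum>j<M. (bcos n (m * Suc j))\<^sup>2 / 2)"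
    unfolding M sum.lessThan_Suc_shift by (simp add: cos_basis_def)
  also have "(\<Sum>j<M. (bcos n (m * Suc j))\<^sup>2 / 2) = (\<Sum>j<M. 1 + bcos n (2 * m * Suc j) / 2)"
    by (intro sum.cong refl) (simp add: bcos_square add_divide_distrib mult.assoc del: mult_Suc_right)
  also have "\<dots> = real M + S / 2" by (simp add: sum.distrib S_def sum_divide_distrib)
  finally show ?thesis using \<open>S = 0\<close> M by (metis add.commute add.right_neutral div_0 of_nat_Suc of_nat_numeral of_nat_power)
qed

text \<open>Orthogonality extracts each diagonal entry of the multiplication matrix as a weighted
  mean over the conjugates. Summed over the basis, the weights of each conjugate add up to 1 by
  \<open>sum_cos_basis_squares\<close>.\<close>

lemma field_trace_B_field:
  assumes n: "n > 0" and q: "poly_over \<rat> q"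
  shows "field_trace (B_field n) \<rat> (poly q (bcos n 1)) = (\<Sum>i<2 ^ n. poly q (bcos n (2 * i + 1)))"
proof -
  define us where "us = map (cos_basis n 1) [0..<2 ^ n]"
  have len: "length us = 2 ^ n" and us: "\<And>k. k < 2 ^ n \<Longrightarrow> us ! k = cos_basis n 1 k"
    by (simp_all add: us_def)
  have basis: "field_basis \<rat> (B_field n) us"
    unfolding field_basis_iff_sums[OF is_real_field_Rats] len
  proof (intro conjI allI impI)
    fix c and i :: nat assume "\<forall>i<2 ^ n. c i \<in> \<rat>" "(\<Sum>i<2 ^ n. c i * us ! i) = 0" "i < 2 ^ n"
    thus "c i = 0" using cos_basis_independent[OF n, of c i] us by simp
  next
    have "B_field n = {\<Sum>k<2 ^ n. c k * us ! k | c. \<forall>k. c k \<in> \<rat>}"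
      unfolding B_field_eq adjoin_bcos_eq[OF is_real_subring_Rats Ints_subset_Rats]
      using us by (auto intro!: Collect_cong)
    also have "\<dots> = {\<Sum>k<2 ^ n. c k * us ! k | c. \<forall>k<2 ^ n. c k \<in> \<rat>}"
    proof (intro equalityI subsetI)
      fix x assume "x \<in> {\<Sum>k<2 ^ n. c k * us ! k | c. \<forall>k<2 ^ n. c k \<in> \<rat>}"
      then obtain c where "x = (\<Sum>k<2 ^ n. c k * us ! k)" "\<forall>k<2 ^ n. c k \<in> \<rat>" by blast
      thus "x \<in> {\<Sum>k<2 ^ n. c k * us ! k | c. \<forall>k. c k \<in> \<rat>}"
        by (intro CollectI exI[of _ "\<lambda>k. if k < 2 ^ n then c k else 0"]) auto
    qed blast
    finally show "B_field n = {\<Sum>k<2 ^ n. c k * us ! k | c. \<forall>k<2 ^ n. c k \<in> \<rat>}" .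
  qed
  \<comment> \<open>One choice of matrix entries serves all conjugates at once, as
    \<open>cos_basis_inner\<close> requires.\<close>
  have "\<exists>C. (\<forall>i. C i \<in> \<rat>) \<and>
      (\<forall>m. odd m \<longrightarrow> poly q (bcos n m) * cos_basis n m j = (\<Sum>i<2 ^ n. C i * cos_basis n m i))" for j
  proof -
    have "poly_over \<rat> (q * of_int_poly (basis_poly j))"
      by (intro poly_over_mult is_real_subring_Rats q poly_over_of_int_poly Ints_subset_Rats)
    thus ?thesis using cos_comb_poly[OF is_real_subring_Rats, of "q * of_int_poly (basis_poly j)" n]
      unfolding cos_comb_def by (simp add: poly_basis_poly)
  qed
  then obtain C where C: "\<And>j i. C j i \<in> \<rat>"
    "\<And>j m. odd m \<Longrightarrow> poly q (bcos n m) * cos_basis n m j = (\<Sum>i<2 ^ n. C j i * cos_basis n m i)"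
    by metis
  define A where "A = mat (2 ^ n) (2 ^ n) (\<lambda>(i, j). C j i)"
  have "is_mult_matrix \<rat> us (poly q (bcos n 1)) A"
    unfolding is_mult_matrix_def len using C(1) C(2)[of 1] us by (simp add: A_def)
  hence "field_trace (B_field n) \<rat> (poly q (bcos n 1)) = (\<Sum>j<2 ^ n. C j j)"
    using field_trace_eq_sum[OF is_real_field_Rats basis] len by (simp add: A_def)
  also have "\<dots> = (\<Sum>j<2 ^ n. (\<Sum>i<2 ^ n. poly q (bcos n (2 * i + 1)) *
      ((cos_basis n (2 * i + 1) j)\<^sup>2 / (if j = 0 then 1 else 2)) / 2 ^ n))"
  proof (rule sum.cong[OF refl])
    fix j :: nat assume "j \<in> {..<2 ^ n}"
    hence j: "j < 2 ^ n" by simp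
    have "(\<Sum>i<2 ^ n. (poly q (bcos n (2 * i + 1)) * cos_basis n (2 * i + 1) j) * cos_basis n (2 * i + 1) j) =
      (\<Sum>k<2 ^ n. C j k * (if k = j then 1 else 0) * (if k = 0 then 2 ^ n else 2 * 2 ^ n))"
      by (rule cos_basis_inner) (use C(2) j in \<open>auto simp: if_distrib[of "\<lambda>x. x * _"] cong: if_cong\<close>)
    also have "\<dots> = (\<Sum>k<2 ^ n. if k = j then C j j * (if j = 0 then 2 ^ n else 2 * 2 ^ n) else 0)"
      by (intro sum.cong refl) auto
    also have "\<dots> = C j j * ((if j = 0 then 1 else 2) * 2 ^ n)" using j by simp
    finally have "C j j = (\<Sum>i<2 ^ n. (poly q (bcos n (2 * i + 1)) * cos_basis n (2 * i + 1) j) *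
      cos_basis n (2 * i + 1) j) / ((if j = 0 then 1 else 2) * 2 ^ n)" by (simp add: field_simps)
    thus "C j j = (\<Sum>i<2 ^ n. poly q (bcos n (2 * i + 1)) *
      ((cos_basis n (2 * i + 1) j)\<^sup>2 / (if j = 0 then 1 else 2)) / 2 ^ n)"
      unfolding sum_divide_distrib by (simp add: power2_eq_square mult_ac)
  qed
  also have "\<dots> = (\<Sum>i<2 ^ n. poly q (bcos n (2 * i + 1)) *
      (\<Sum>j<2 ^ n. (cos_basis n (2 * i + 1) j)\<^sup>2 / (if j = 0 then 1 else 2)) / 2 ^ n)"
    by (subst sum.swap) (simp add: sum_distrib_left sum_divide_distrib)
  also have "\<dots> = (\<Sum>i<2 ^ n. poly q (bcos n (2 * i + 1)))"
    by (simp add: sum_cos_basis_squares)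
  finally show ?thesis .
qed

section \<open>The Pell equation\<close>

text \<open>Since \<open>t\<close> divides 2, every element is congruent to 0 or 1 modulo
  \<open>t\<close>. If \<open>r\<close> were congruent to 1, so would be \<open>r * r\<close>, which
  \<open>t\<close> divides, and \<open>t\<close> would be a unit.\<close>

lemma adjoin_prime_square:
  assumes two: "2 = t * h" "h \<in> adjoin \<int> t" and nonunit: "\<And>y. y \<in> adjoin \<int> t \<Longrightarrow> t * y \<noteq> 1"
    and r: "r \<in> adjoin \<int> t" and s: "s \<in> adjoin \<int> t" "r * r = t * s"
  obtains r' where "r' \<in> adjoin \<int> t" "r = t * r'"
proof -
  note R = is_real_subringD[OF is_real_subring_adjoin[OF is_real_subring_Ints, of t]]
  obtain a y where ay: "a \<in> \<int>" "y \<in> adjoin \<int> t" "r = a + t * y"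
    using adjoin_split[OF is_real_subring_Ints r] by blast
  then obtain i where i: "a = of_int i" by (auto elim: Ints_cases)
  have t: "t \<in> adjoin \<int> t" by (rule adjoin_gen[OF is_real_subring_Ints])
  have int: "of_int j \<in> adjoin \<int> t" for j by (rule adjoin_base[OF is_real_subring_Ints]) simp
  have "even i"
  proof (rule ccontr)
    assume "odd i"
    then obtain j where j: "i = 2 * j + 1" by (elim oddE)
    have a: "a = t * h * of_int j + 1" unfolding i j two(1)[symmetric] by simp
    have "r = 1 + t * (h * of_int j + y)" using ay(3) a by (simp add: algebra_simps)
    moreover define g where "g = h * of_int j + y"
    ultimately have "t * (s - 2 * g - t * g * g) = 1" using s(2) by (simp add: algebra_simps)
    moreover have "s - 2 * g - t * g * g \<in> adjoin \<int> t"
      unfolding g_def using s(1) two(2) int ay(2) t by (intro R)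
    ultimately show False using nonunit by blast
  qed
  then obtain j where "i = 2 * j" by (elim evenE)
  hence "a = t * h * of_int j" unfolding i two(1)[symmetric] by simp
  hence "r = t * (h * of_int j + y)" using ay(3) by (simp add: algebra_simps)
  moreover have "h * of_int j + y \<in> adjoin \<int> t" using two(2) int ay(2) by (intro R)
  ultimately show thesis using that by blast
qed

text \<open>In \<open>\<int>[t]\<close>, where \<open>t\<close> is a prime element above 2, the factors of
  \<open>(x - 1) * (x + 1) = t * z\<^sup>2\<close> differ by 2, so they have the same valuation until 2 divides
  both; equal valuations are impossible because the right-hand side has odd valuation.\<close>

lemma pell_descent:
  assumes u: "u \<in> adjoin \<int> t" and w: "w \<in> adjoin \<int> t" "w * u = 1" and two: "t ^ M * u = 2" and M: "M > 0"
    and nonunit: "\<And>y. y \<in> adjoin \<int> t \<Longrightarrow> t * y \<noteq> 1"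
    and x: "x \<in> adjoin \<int> t" and z: "z \<in> adjoin \<int> t" and pell: "x\<^sup>2 - t * z\<^sup>2 = 1"
  obtains v y where "v \<in> adjoin \<int> t" "y \<in> adjoin \<int> t" "x = 1 + 2 * v" "z = 2 * y"
proof -
  note R = is_real_subringD[OF is_real_subring_adjoin[OF is_real_subring_Ints, of t]]
  have t: "t \<in> adjoin \<int> t" by (rule adjoin_gen[OF is_real_subring_Ints])
  have t0: "t \<noteq> 0" using two M by (auto simp: power_0_left)
  have two': "2 = t * (t ^ (M - 1) * u)" using two M by (cases M) auto
  have h: "t ^ (M - 1) * u \<in> adjoin \<int> t" using t u by (intro R)
  have div_t: "\<exists>r'\<in>adjoin \<int> t. r = t * r'" if "r \<in> adjoin \<int> t" "s \<in> adjoin \<int> t" "r * r = t * s" for r s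
    using adjoin_prime_square[OF two' h nonunit that] by blast
  \<comment> \<open>The powers of \<open>t\<close> dividing \<open>x - 1\<close> and
    \<open>z\<close> are raised together, up to \<open>t ^ M\<close>, which is 2 times a
    unit.\<close>
  have "\<exists>v\<in>adjoin \<int> t. \<exists>y\<in>adjoin \<int> t. x = 1 + t ^ i * v \<and> z = t ^ i * y" if "i \<le> M" for i
    using that
  proof (induction i)
    case 0
    have "x - 1 \<in> adjoin \<int> t" using x R by blast
    thus ?case using z by (intro bexI[of _ "x - 1"] bexI[of _ z]) auto
  next
    case (Suc i)
    then obtain v y where vy: "v \<in> adjoin \<int> t" "y \<in> adjoin \<int> t" "x = 1 + t ^ i * v" "z = t ^ i * y"
      by auto
    \<comment> \<open>Chosen so that \<open>t ^ i * (t * g) = 2\<close>; then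
      \<open>x + 1 = t ^ i * (v + t * g)\<close>, and \<open>t ^ i * t ^ i\<close> cancels from the
      equation.\<close>
    define g where "g = t ^ (M - Suc i) * u"
    have g: "g \<in> adjoin \<int> t" unfolding g_def using t u by (intro R)
    have "t ^ i * (t * g) = t ^ (i + Suc (M - Suc i)) * u"
      by (simp add: g_def power_add)
    hence two_i: "t ^ i * (t * g) = 2" using Suc.prems two by simp
    have "(t ^ i * t ^ i) * (v * (v + t * g)) = (t ^ i * t ^ i) * (t * (y * y))"
    proof -
      have "(t ^ i * t ^ i) * (v * (v + t * g)) = t ^ i * v * (t ^ i * v + t ^ i * (t * g))"
        by (simp add: algebra_simps)
      also have "\<dots> = x\<^sup>2 - 1" unfolding two_i vy(3) by (simp add: algebra_simps power2_eq_square)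
      also have "\<dots> = t * z\<^sup>2" using pell by simp
      also have "\<dots> = (t ^ i * t ^ i) * (t * (y * y))" by (simp add: vy(4) power2_eq_square mult_ac)
      finally show ?thesis .
    qed
    hence eq: "v * (v + t * g) = t * (y * y)" using t0 by simp
    \<comment> \<open>This gives that \<open>t\<close> divides \<open>v\<close>; then the left side
      of \<open>eq\<close> is divisible by \<open>t * t\<close>, so \<open>t\<close> divides
      \<open>y * y\<close> and hence \<open>y\<close>.\<close>
    hence "v * v = t * (y * y - g * v)" by (simp add: algebra_simps)
    moreover have "y * y - g * v \<in> adjoin \<int> t" using vy g by (intro R)
    ultimately obtain v' where v': "v' \<in> adjoin \<int> t" "v = t * v'" using div_t vy(1) by blast
    have "t * (y * y) = t * (t * (v' * (v' + g)))"
      unfolding eq[symmetric] v'(2) by (simp add: algebra_simps)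
    hence "y * y = t * (v' * (v' + g))" using t0 by simp
    moreover have "v' * (v' + g) \<in> adjoin \<int> t" using v' g by (intro R)
    ultimately obtain y' where y': "y' \<in> adjoin \<int> t" "y = t * y'" using div_t vy(2) by blast
    show ?case using v' y' vy(3,4) by (intro bexI[of _ v'] bexI[of _ y']) auto
  qed
  then obtain v y where vy: "v \<in> adjoin \<int> t" "y \<in> adjoin \<int> t" "x = 1 + t ^ M * v" "z = t ^ M * y"
    by blast
  have "t ^ M = t ^ M * (w * u)" using w(2) by simp
  also have "\<dots> = 2 * w" by (subst two[symmetric]) (simp only: mult_ac)
  finally have tM: "t ^ M = 2 * w" .
  have "w * v \<in> adjoin \<int> t" "w * y \<in> adjoin \<int> t" using w(1) vy by (auto intro: R(7))
  thus thesis using that[of "w * v" "w * y"] vy(3,4) unfolding tM by (simp add: mult.assoc)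
qed

section \<open>Exclusion of a single odd coefficient\<close>

lemma int_sum_squares_eq_1:
  fixes d :: "'a \<Rightarrow> int"
  assumes "finite I" and sum: "(\<Sum>k\<in>I. (d k)\<^sup>2) = 1"
  obtains r where "r \<in> I" "(d r)\<^sup>2 = 1" "\<And>k. k \<in> I \<Longrightarrow> k \<noteq> r \<Longrightarrow> d k = 0"
proof -
  have "\<exists>r\<in>I. d r \<noteq> 0"
  proof (rule ccontr)
    assume "\<not> (\<exists>r\<in>I. d r \<noteq> 0)"
    hence "(\<Sum>k\<in>I. (d k)\<^sup>2) = 0" by simp
    thus False using sum by simp
  qed
  then obtain r where r: "r \<in> I" "d r \<noteq> 0" by blast
  have split: "(d r)\<^sup>2 + (\<Sum>k\<in>I - {r}. (d k)\<^sup>2) = 1"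
    using sum sum.remove[OF assms(1) r(1), of "\<lambda>k. (d k)\<^sup>2"] by simp
  have "(d r)\<^sup>2 > 0" using r(2) by simp
  moreover have nonneg: "(\<Sum>k\<in>I - {r}. (d k)\<^sup>2) \<ge> 0" by (rule sum_nonneg) simp
  ultimately have "(d r)\<^sup>2 = 1" "(\<Sum>k\<in>I - {r}. (d k)\<^sup>2) = 0" using split by linarith+
  moreover from this(2) have "\<forall>k\<in>I - {r}. (d k)\<^sup>2 = 0"
    using assms(1) by (subst (asm) sum_nonneg_eq_0_iff) auto
  ultimately show thesis using that[OF r(1)] by simp
qed

text \<open>The multiplier \<open>2 ^ n + 1\<close> sends \<open>\<zeta> ^ 2\<close> to
  \<open>- (\<zeta> ^ 2)\<close>; this conjugation separates the indices divisible by 4 from the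
  other even ones.\<close>

lemma bcos_even_conjugate: "bcos n ((2 ^ n + 1) * (2 * j)) = (- 1) ^ j * bcos n (2 * j)"
proof -
  have "(2 ^ n + 1) * (2 * j) = j * 2 ^ (n + 1) + 2 * j" by (simp add: algebra_simps)
  thus ?thesis by (simp only: bcos_shift)
qed

text \<open>Zeros occur only at multiples of \<open>2 ^ n\<close>, and \<open>n \<ge> 3\<close>
  makes these multiples of 8.\<close>

lemma bcos_nonzero_if_not_8_dvd:
  assumes "n \<ge> 3" "\<not> 8 dvd k"
  shows "bcos n k \<noteq> 0"
proof
  assume "bcos n k = 0"
  then obtain i where "k = i * 2 ^ n" unfolding bcos_eq_0_iff by blast
  moreover have "(2 :: nat) ^ 3 dvd 2 ^ n" using assms(1) by (rule le_imp_power_dvd)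
  ultimately show False using assms(2) by simp
qed

text \<open>Compare \<open>m = 1\<close> with \<open>m = 2 ^ n + 1\<close>, where the left side
  changes sign and the last term does not. With \<open>k = 2 * j\<close>, the middle term keeps its
  sign for even \<open>j\<close>, which forces \<open>bcos n (2 * r) = 0\<close>; for odd
  \<open>j\<close> it flips, which forces \<open>bcos n (4 * j) = 0\<close>.\<close>

lemma no_bcos_relation:
  assumes n: "n \<ge> 3" and "odd r" "even k"
    and rel: "\<And>m. odd m \<Longrightarrow> bcos n (m * (2 * r)) = s * bcos n (m * k) + bcos n (m * (2 * k))"
  shows False
proof -
  obtain j where k: "k = 2 * j" using assms(3) by (elim evenE)
  have odd: "odd (2 ^ n + 1 :: nat)" using n by simp
  have 1: "bcos n (2 * r) = s * bcos n (2 * j) + bcos n (2 * (2 * j))"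
    using rel[of 1] by (simp add: k)
  have 2: "- bcos n (2 * r) = s * ((- 1) ^ j * bcos n (2 * j)) + bcos n (2 * (2 * j))"
    using rel[OF odd] assms(2) unfolding k bcos_even_conjugate by simp
  show False
  proof (cases "even j")
    case True
    hence "bcos n (2 * r) = 0" using 1 2 by simp
    moreover have "\<not> 8 dvd 2 * r" using assms(2) by presburger
    ultimately show False using bcos_nonzero_if_not_8_dvd[OF n] by blast
  next
    case False
    hence "bcos n (2 * (2 * j)) = 0" using 1 2 by simp
    moreover have "\<not> 8 dvd 2 * (2 * j)" using False by presburger
    ultimately show False using bcos_nonzero_if_not_8_dvd[OF n] by blast
  qed
qed

lemma pell_coeffs_not_single:
  fixes d e :: "nat \<Rightarrow> int"
  assumes n: "n \<ge> 3"
    and d: "\<And>k. even k \<Longrightarrow> d k = 0" and e: "\<And>k. odd k \<Longrightarrow> e k = 0"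
    and F: "\<And>m. odd m \<Longrightarrow> F m = (\<Sum>k<2 ^ n. of_int (e k) * cos_basis n m k)"
    and G: "\<And>m. odd m \<Longrightarrow> G m = (\<Sum>k<2 ^ n. of_int (d k) * cos_basis n m k)"
    and pell: "\<And>m. odd m \<Longrightarrow> (1 + 2 * F m)\<^sup>2 - (2 * G m)\<^sup>2 = 1"
  shows "(\<Sum>k<2 ^ n. (d k)\<^sup>2) \<noteq> 1"
proof
  assume "(\<Sum>k<2 ^ n. (d k)\<^sup>2) = 1"
  then obtain r where r: "r < 2 ^ n" "(d r)\<^sup>2 = 1" "\<And>k. k < 2 ^ n \<Longrightarrow> k \<noteq> r \<Longrightarrow> d k = 0"
    using int_sum_squares_eq_1[of "{..<2 ^ n}" d] by auto
  have "odd r" using d[of r] r(2) by auto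
  hence "r > 0" by (rule odd_pos)
  have dr: "(real_of_int (d r))\<^sup>2 = 1" using r(2) by (metis of_int_1 of_int_power)
  \<comment> \<open>Up to sign \<open>G m\<close> is \<open>bcos n (m * r)\<close>, so the Pell
    equation gives \<open>1 + 4 * (2 + bcos n (m * (2 * r)))\<close>.\<close>
  have sq: "(1 + 2 * F m)\<^sup>2 = 9 + 4 * bcos n (m * (2 * r))" if "odd m" for m
  proof -
    have "G m = (\<Sum>k<2 ^ n. if k = r then of_int (d r) * bcos n (m * r) else 0)"
      unfolding G[OF that] using r(3) \<open>r > 0\<close> by (intro sum.cong) (auto simp: cos_basis_def)
    hence "G m = of_int (d r) * bcos n (m * r)" using r(1) by simp
    hence "(2 * G m)\<^sup>2 = 4 * (bcos n (m * r))\<^sup>2" using dr by (simp add: power_mult_distrib)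
    thus ?thesis using pell[OF that] by (simp add: bcos_square mult_ac)
  qed
  define f :: "nat \<Rightarrow> int" where "f k = (if k = 0 then 1 + 2 * e 0 else 2 * e k)" for k
  have f: "1 + 2 * F m = (\<Sum>k<2 ^ n. of_int (f k) * cos_basis n m k)" if "odd m" for m
  proof -
    have N: "(2 :: nat) ^ n = Suc (2 ^ n - 1)" by simp
    show ?thesis unfolding F[OF that]
      by (subst (1 2) N, unfold sum.lessThan_Suc_shift)
         (simp add: f_def cos_basis_def distrib_left sum_distrib_left mult.assoc del: sum.lessThan_Suc)
  qed
  define E where "E = (\<Sum>k\<in>{1..<2 ^ n}. (e k)\<^sup>2)"
  \<comment> \<open>The trace of \<open>(1 + 2 * F)\<^sup>2\<close> over \<open>2 ^ n\<close>,
    computed from the coefficients and from \<open>sq\<close>; \<open>bcos n (2 * r)\<close> has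
    trace 0 because \<open>0 < 2 * r < 2 ^ (n + 1)\<close>.\<close>
  have sq_sum: "(1 + 2 * e 0)\<^sup>2 + 8 * E = 9"
  proof -
    have split: "{..<(2 :: nat) ^ n} = insert 0 {1..<2 ^ n}" by auto
    have "(\<Sum>i<2 ^ n. (1 + 2 * F (2 * i + 1)) * (1 + 2 * F (2 * i + 1))) =
      (\<Sum>k<2 ^ n. of_int (f k) * of_int (f k) * (if k = 0 then 2 ^ n else 2 * 2 ^ n))"
      by (rule cos_basis_inner[OF f f])
    also have "\<dots> = 2 ^ n * of_int ((1 + 2 * e 0)\<^sup>2 + 8 * E)"
      unfolding split by (simp add: f_def E_def power2_eq_square sum_distrib_left algebra_simps)
    finally have 1: "(\<Sum>i<2 ^ n. (1 + 2 * F (2 * i + 1))\<^sup>2) = 2 ^ n * of_int ((1 + 2 * e 0)\<^sup>2 + 8 * E)"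
      by (simp only: power2_eq_square)
    have "(\<Sum>i<2 ^ n. (1 + 2 * F (2 * i + 1))\<^sup>2) = (\<Sum>i<2 ^ n. 9 + 4 * bcos n ((2 * i + 1) * (2 * r)))"
      by (intro sum.cong refl sq) simp
    also have "\<dots> = 9 * 2 ^ n + 4 * (\<Sum>i<2 ^ n. bcos n ((2 * i + 1) * (2 * r)))"
      unfolding sum.distrib sum_distrib_left by simp
    also have "\<dots> = 2 ^ n * of_int 9" using sum_bcos_odd[of "2 * r" n] r(1) \<open>r > 0\<close> by simp
    finally have "2 ^ n * real_of_int 9 = 2 ^ n * real_of_int ((1 + 2 * e 0)\<^sup>2 + 8 * E)" using 1 by simp
    hence "real_of_int 9 = real_of_int ((1 + 2 * e 0)\<^sup>2 + 8 * E)"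
      by (metis mult_left_cancel power_not_zero zero_neq_numeral)
    thus ?thesis by (simp only: of_int_eq_iff)
  qed
  have "E \<ge> 0" unfolding E_def by (rule sum_nonneg) simp
  moreover have "(1 + 2 * e 0)\<^sup>2 \<ge> 0" by simp
  ultimately consider "E = 0" | "E = 1" using sq_sum by linarith
  thus False
  proof cases
    \<comment> \<open>Here \<open>1 + 2 * F 1\<close> is 3 up to sign, and \<open>sq\<close> forces
      \<open>bcos n (2 * r) = 0\<close>.\<close>
    case 1
    hence "\<forall>k\<in>{1..<2 ^ n}. (e k)\<^sup>2 = 0"
      unfolding E_def by (subst (asm) sum_nonneg_eq_0_iff) auto
    hence "F 1 = (\<Sum>k<(2 :: nat) ^ n. if k = 0 then of_int (e 0) else 0)"
      unfolding F[OF odd_one] by (intro sum.cong) (auto simp: cos_basis_def)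
    hence "F 1 = of_int (e 0)" by simp
    hence "real_of_int ((1 + 2 * e 0)\<^sup>2) = 9 + 4 * bcos n (2 * r)" using sq[OF odd_one] by simp
    moreover have "real_of_int ((1 + 2 * e 0)\<^sup>2) = 9"
      using sq_sum 1 by (metis add.right_neutral mult_zero_right of_int_numeral)
    ultimately have "bcos n (2 * r) = 0" by linarith
    moreover have "\<not> 8 dvd 2 * r" using \<open>odd r\<close> by presburger
    ultimately show False using bcos_nonzero_if_not_8_dvd[OF n] by blast
  next
    case 2
    then obtain k where k: "k \<in> {1..<2 ^ n}" "(e k)\<^sup>2 = 1" "\<And>j. j \<in> {1..<2 ^ n} \<Longrightarrow> j \<noteq> k \<Longrightarrow> e j = 0"
      using int_sum_squares_eq_1[of "{1..<2 ^ n}" e] unfolding E_def by auto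
    have "even k"
    proof (rule ccontr)
      assume "odd k"
      hence "e k = 0" by (rule e)
      thus False using k(2) by simp
    qed
    define s t where "s = real_of_int (1 + 2 * e 0)" and "t = real_of_int (e k)"
    have s2: "s\<^sup>2 = 1" using sq_sum 2 unfolding s_def of_int_power[symmetric] by simp
    have t2: "t\<^sup>2 = 1" using k(2) unfolding t_def by (metis of_int_1 of_int_power)
    \<comment> \<open>Here \<open>1 + 2 * F m = s + 2 * t * bcos n (m * k)\<close> with signs
      \<open>s\<close> and \<open>t\<close>; its square is compared with \<open>sq\<close>.\<close>
    have "bcos n (m * (2 * r)) = (s * t) * bcos n (m * k) + bcos n (m * (2 * k))" if "odd m" for m
    proof -
      have "F m = (\<Sum>j<2 ^ n. (if j = 0 then of_int (e 0) else 0) + (if j = k then t * bcos n (m * k) else 0))"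
        unfolding F[OF that] using k by (intro sum.cong) (auto simp: cos_basis_def t_def)
      hence "F m = of_int (e 0) + t * bcos n (m * k)" using k(1) by (simp add: sum.distrib)
      hence "1 + 2 * F m = s + 2 * t * bcos n (m * k)" by (simp add: s_def)
      hence "(1 + 2 * F m)\<^sup>2 = s\<^sup>2 + 4 * (s * t) * bcos n (m * k) + 4 * t\<^sup>2 * (bcos n (m * k))\<^sup>2"
        by (simp add: power2_eq_square algebra_simps)
      also have "\<dots> = 9 + 4 * (s * t) * bcos n (m * k) + 4 * bcos n (m * (2 * k))"
        by (simp add: s2 t2 bcos_square mult_ac)
      finally show ?thesis using sq[OF that] by simp
    qed
    thus False by (rule no_bcos_relation[OF n \<open>odd r\<close> \<open>even k\<close>])
  qed
qed

text \<open>The Pell equation turns the summand into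
  \<open>1 + 8 * G\<^sup>2 + 4 * G + 8 * G * F\<close>. The last two terms sum to 0, as
  \<open>G\<close> has only odd indices while 1 and \<open>F\<close> have only even ones. What
  remains is \<open>2 ^ n * (1 + 16 * D)\<close>, and \<open>D = 2\<close> gives 33.\<close>

lemma pell_sum_bound:
  fixes d e :: "nat \<Rightarrow> int"
  assumes n: "n \<ge> 3"
    and d: "\<And>k. even k \<Longrightarrow> d k = 0" and e: "\<And>k. odd k \<Longrightarrow> e k = 0"
    and F: "\<And>m. odd m \<Longrightarrow> F m = (\<Sum>k<2 ^ n. of_int (e k) * cos_basis n m k)"
    and G: "\<And>m. odd m \<Longrightarrow> G m = (\<Sum>k<2 ^ n. of_int (d k) * cos_basis n m k)"
    and pell: "\<And>m. odd m \<Longrightarrow> (1 + 2 * F m)\<^sup>2 - (2 * G m)\<^sup>2 = 1"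
    and nonzero: "G 1 \<noteq> 0"
  shows "(\<Sum>i<2 ^ n. (1 + 2 * F (2 * i + 1) + 2 * G (2 * i + 1))\<^sup>2) \<ge> 33 * 2 ^ n"
proof -
  define D where "D = (\<Sum>k<2 ^ n. (d k)\<^sup>2)"
  have "D \<ge> 0" unfolding D_def by (rule sum_nonneg) simp
  moreover have "D \<noteq> 0"
  proof
    assume "D = 0"
    hence "\<forall>k\<in>{..<2 ^ n}. (d k)\<^sup>2 = 0"
      unfolding D_def by (subst (asm) sum_nonneg_eq_0_iff) auto
    hence "G 1 = 0" unfolding G[OF odd_one] by simp
    thus False using nonzero by simp
  qed
  moreover have "D \<noteq> 1" unfolding D_def by (rule pell_coeffs_not_single[OF n d e F G pell])
  ultimately have "D \<ge> 2" by linarith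
  have one: "1 = (\<Sum>k<2 ^ n. (if k = 0 then 1 else 0) * cos_basis n m k)" for m
    by (simp add: if_distrib[of "\<lambda>x. x * _"] cos_basis_def cong: if_cong)
  have GG: "(\<Sum>i<2 ^ n. G (2 * i + 1) * G (2 * i + 1)) = 2 * 2 ^ n * of_int D"
  proof -
    have "(\<Sum>i<2 ^ n. G (2 * i + 1) * G (2 * i + 1)) =
      (\<Sum>k<2 ^ n. of_int (d k) * of_int (d k) * (if k = 0 then 2 ^ n else 2 * 2 ^ n))"
      by (rule cos_basis_inner[OF G G])
    also have "\<dots> = (\<Sum>k<2 ^ n. 2 * 2 ^ n * of_int ((d k)\<^sup>2))"
      using d[of 0] by (intro sum.cong) (auto simp: power2_eq_square)
    finally show ?thesis by (simp add: D_def sum_distrib_left)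
  qed
  have GF: "(\<Sum>i<2 ^ n. G (2 * i + 1) * F (2 * i + 1)) = 0"
  proof -
    have "(\<Sum>i<2 ^ n. G (2 * i + 1) * F (2 * i + 1)) =
      (\<Sum>k<2 ^ n. of_int (d k) * of_int (e k) * (if k = 0 then 2 ^ n else 2 * 2 ^ n))"
      by (rule cos_basis_inner[OF G F])
    also have "\<dots> = 0" using d e by (intro sum.neutral) (metis mult_eq_0_iff of_int_0)
    finally show ?thesis .
  qed
  have G1: "(\<Sum>i<2 ^ n. G (2 * i + 1)) = 0"
  proof -
    have "(\<Sum>i<2 ^ n. G (2 * i + 1) * 1) =
      (\<Sum>k<2 ^ n. of_int (d k) * (if k = 0 then 1 else 0) * (if k = 0 then 2 ^ n else 2 * 2 ^ n))"
      by (rule cos_basis_inner[OF G one])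
    also have "\<dots> = 0" using d[of 0] by (intro sum.neutral) auto
    finally show ?thesis by simp
  qed
  have "(\<Sum>i<2 ^ n. (1 + 2 * F (2 * i + 1) + 2 * G (2 * i + 1))\<^sup>2) =
    (\<Sum>i<2 ^ n. 1 + 8 * (G (2 * i + 1) * G (2 * i + 1)) + 4 * G (2 * i + 1) + 8 * (G (2 * i + 1) * F (2 * i + 1)))"
  proof (rule sum.cong[OF refl])
    fix i
    have "(1 + 2 * F (2 * i + 1))\<^sup>2 - (2 * G (2 * i + 1))\<^sup>2 = 1" by (rule pell) simp
    thus "(1 + 2 * F (2 * i + 1) + 2 * G (2 * i + 1))\<^sup>2 =
      1 + 8 * (G (2 * i + 1) * G (2 * i + 1)) + 4 * G (2 * i + 1) + 8 * (G (2 * i + 1) * F (2 * i + 1))"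
      by (simp add: power2_eq_square algebra_simps)
  qed
  also have "\<dots> = 2 ^ n + 16 * 2 ^ n * of_int D"
    unfolding sum.distrib sum_distrib_left[symmetric] GG GF G1 by simp
  also have "\<dots> \<ge> 2 ^ n + 16 * 2 ^ n * of_int 2"
    using \<open>D \<ge> 2\<close> by (intro add_left_mono mult_left_mono) (simp_all only: of_int_le_iff, simp)
  finally show ?thesis by simp
qed

text \<open>The conjugation that negates the generator multiplies the basis element \<open>k\<close>
  by \<open>(- 1) ^ k\<close>, so an eigenvector for \<open>s\<close> involves only indices of that
  sign. Even and odd polynomials in the generator thereby get coefficients of one parity.\<close>

lemma cos_coeffs_parity:
  assumes n: "n > 0" and c: "\<And>k. c k \<in> \<rat>"
    and F: "\<And>m. odd m \<Longrightarrow> F m = (\<Sum>k<2 ^ n. c k * cos_basis n m k)"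
    and sym: "F (2 ^ (n + 1) - 1) = s * F 1" and s: "s \<in> \<rat>" and k: "k < 2 ^ n" "s \<noteq> (- 1) ^ k"
  shows "c k = 0"
proof -
  have basis: "cos_basis n (2 ^ (n + 1) - 1) k = (- 1) ^ k * cos_basis n 1 k" for k
    using bcos_neg_conjugate[of n k] by (simp add: cos_basis_def)
  have "(\<Sum>k<2 ^ n. ((- 1) ^ k - s) * c k * cos_basis n 1 k) =
    (\<Sum>k<2 ^ n. c k * cos_basis n (2 ^ (n + 1) - 1) k) - s * (\<Sum>k<2 ^ n. c k * cos_basis n 1 k)"
    unfolding basis sum_distrib_left sum_subtractf[symmetric]
    by (intro sum.cong refl) (simp add: algebra_simps)
  also have "\<dots> = 0"
    using sym F[OF odd_neg_conjugate] F[OF odd_one] by simp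
  finally have "((- 1) ^ k - s) * c k = 0"
    by (intro cos_basis_independent[OF n, of "\<lambda>k. ((- 1) ^ k - s) * c k"])
       (use c s k in \<open>auto intro!: Rats_mult Rats_diff Rats_power\<close>)
  thus ?thesis using k(2) by simp
qed

theorem theorem2p3:
  fixes n :: nat and \<epsilon> :: real
  assumes "n \<ge> 3"
    and "\<epsilon> \<in> RE_plus n"
    and "\<epsilon> \<noteq> 1" and "\<epsilon> \<noteq> - 1"
  shows "field_trace (B_field n) \<rat> (\<epsilon>\<^sup>2) \<ge> 33 * 2 ^ n"
proof -
  obtain n' where n': "n = Suc n'" using assms(1) by (cases n) auto
  have n: "n > 0" using n' by simp
  define l where "l = bcos n 1"
  note ZZ = is_real_subring_Ints and QQ = is_real_subring_Rats
  have unit: "\<epsilon> \<in> integer_units (B_field n)" and norm: "field_norm (B_field n) (B_field n') \<epsilon> = 1"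
    using assms(2) by (simp_all add: RE_plus_def n')
  from unit have \<epsilon>: "\<epsilon> \<in> B_field n" "algebraic_int \<epsilon>"
    by (auto simp: integer_units_def Units_def ring_of_integers_def)
  hence "\<epsilon> \<in> adjoin \<int> l" using adjoin_Ints_if_algebraic_int[OF n] unfolding B_field_eq l_def by blast
  then obtain x z where xz: "x \<in> adjoin \<int> (l\<^sup>2)" "z \<in> adjoin \<int> (l\<^sup>2)" "\<epsilon> = x + l * z"
    using adjoin_square_split[OF ZZ] by blast
  have sub: "adjoin \<int> (l\<^sup>2) \<subseteq> B_field n'"
  proof -
    have "l\<^sup>2 \<in> adjoin \<rat> (l\<^sup>2)" by (rule adjoin_gen[OF QQ])
    moreover have "\<int> \<subseteq> adjoin \<rat> (l\<^sup>2)" using adjoin_base[OF QQ] Ints_subset_Rats by blast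
    ultimately have "adjoin \<int> (l\<^sup>2) \<subseteq> adjoin \<rat> (l\<^sup>2)"
      by (intro adjoin_subset ZZ is_real_subring_adjoin QQ)
    thus ?thesis unfolding l_def n' adjoin_bcos_square[OF QQ] B_field_eq .
  qed
  have pell: "x\<^sup>2 - l\<^sup>2 * z\<^sup>2 = 1"
    using field_norm_B_field[of x n' z] xz sub norm unfolding l_def n' by auto
  obtain u w where uw: "u \<in> adjoin \<int> (l\<^sup>2)" "w \<in> adjoin \<int> (l\<^sup>2)" "w * u = 1" "(l\<^sup>2) ^ (2 ^ n') * u = 2"
    unfolding l_def n' by (rule two_ramified)
  have l_int: "algebraic_int l" unfolding l_def by (rule algebraic_int_bcos_1)
  \<comment> \<open>Otherwise \<open>l * y\<close> would be an integral inverse of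
    \<open>l\<close>.\<close>
  have nonunit: "l\<^sup>2 * y \<noteq> 1" if "y \<in> adjoin \<int> (l\<^sup>2)" for y
  proof -
    have "algebraic_int (l * y)"
      using that l_int algebraic_int_adjoin_Ints by (intro algebraic_int_mult) (auto intro: algebraic_int_power)
    thus ?thesis using bcos_1_not_unit[of "l * y" n'] unfolding l_def n'
      by (simp add: power2_eq_square mult.assoc)
  qed
  obtain v y where vy: "v \<in> adjoin \<int> (l\<^sup>2)" "y \<in> adjoin \<int> (l\<^sup>2)" "x = 1 + 2 * v" "z = 2 * y"
    using pell_descent[OF uw(1-4) _ nonunit xz(1,2) pell] by auto
  obtain V Y where V: "poly_over \<int> V" "v = poly V (l\<^sup>2)" and Y: "poly_over \<int> Y" "y = poly Y (l\<^sup>2)"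
    using vy(1,2) unfolding adjoin_def by blast
  define T where "T = [:0, 1 :: real:]"
  \<comment> \<open>Even and odd polynomials in the generator itself, with values \<open>v\<close>
    and \<open>l * y\<close> at \<open>l\<close>: they can be evaluated at every conjugate, and
    their parity fixes that of the cosine indices.\<close>
  define FP GP where "FP = V \<circ>\<^sub>p (T * T)" and "GP = T * (Y \<circ>\<^sub>p (T * T))"
  have T: "poly_over \<int> T" by (simp add: T_def poly_over_pCons poly_over_0[OF ZZ])
  have FP: "poly_over \<int> FP" and GP: "poly_over \<int> GP"
    unfolding FP_def GP_def using ZZ T V(1) Y(1)
    by (auto intro!: poly_over_mult poly_over_pcompose)
  have FP_eval: "poly FP a = poly V (a\<^sup>2)" and GP_eval: "poly GP a = a * poly Y (a\<^sup>2)" for a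
    by (simp_all add: FP_def GP_def T_def poly_pcompose power2_eq_square)
  define F G where "F m = poly FP (bcos n m)" and "G m = poly GP (bcos n m)" for m
  have coeffs: "\<exists>c :: nat \<Rightarrow> int. \<forall>m. odd m \<longrightarrow> poly p (bcos n m) = (\<Sum>k<2 ^ n. of_int (c k) * cos_basis n m k)"
    if p: "poly_over \<int> p" for p
  proof -
    obtain c where "\<forall>k. c k \<in> \<int>" "\<forall>m. odd m \<longrightarrow> poly p (bcos n m) = (\<Sum>k<2 ^ n. c k * cos_basis n m k)"
      using cos_comb_poly[OF ZZ p, of n] unfolding cos_comb_def by blast
    thus ?thesis by (intro exI[of _ "\<lambda>k. \<lfloor>c k\<rfloor>"]) simp
  qed
  obtain e :: "nat \<Rightarrow> int" where e: "\<And>m. odd m \<Longrightarrow> F m = (\<Sum>k<2 ^ n. of_int (e k) * cos_basis n m k)"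
    using coeffs[OF FP] unfolding F_def by blast
  obtain d :: "nat \<Rightarrow> int" where d: "\<And>m. odd m \<Longrightarrow> G m = (\<Sum>k<2 ^ n. of_int (d k) * cos_basis n m k)"
    using coeffs[OF GP] unfolding G_def by blast
  have neg: "bcos n (2 ^ (n + 1) - 1) = - bcos n 1" using bcos_neg_conjugate[of n 1] by simp
  have e0: "e k = 0" if "odd k" "k < 2 ^ n" for k
  proof -
    have "F (2 ^ (n + 1) - 1) = 1 * F 1" unfolding F_def FP_eval neg by simp
    from cos_coeffs_parity[OF n _ e this _ that(2)] that(1) have "real_of_int (e k) = 0" by simp
    thus ?thesis by simp
  qed
  have d0: "d k = 0" if "even k" "k < 2 ^ n" for k
  proof -
    have "G (2 ^ (n + 1) - 1) = - 1 * G 1" unfolding G_def GP_eval neg by simp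
    from cos_coeffs_parity[OF n _ d this _ that(2)] that(1) have "real_of_int (d k) = 0" by simp
    thus ?thesis by simp
  qed
  \<comment> \<open>Coefficients from \<open>2 ^ n\<close> on are set to 0, since
    \<open>pell_sum_bound\<close> asks for the parity condition at every index.\<close>
  define e' d' where "e' k = (if k < 2 ^ n then e k else 0)" and "d' k = (if k < 2 ^ n then d k else 0)" for k
  have pell_conj: "(1 + 2 * F m)\<^sup>2 - (2 * G m)\<^sup>2 = 1" if "odd m" for m
  proof -
    \<comment> \<open>The left side of the Pell equation as a polynomial; its value 1 at
      \<open>bcos n 1\<close> is a rational relation and passes to every conjugate.\<close>
    define P where "P = ([:1:] + [:2:] * FP) * ([:1:] + [:2:] * FP) - ([:2:] * GP) * ([:2:] * GP)"
    have int_rat: "poly_over \<rat> p" if "poly_over \<int> p" for p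
      using that Ints_subset_Rats unfolding poly_over_def by blast
    have P: "poly_over \<rat> P" unfolding P_def
      by (intro int_rat poly_over_diff poly_over_mult poly_over_add poly_over_const ZZ FP GP) auto
    have one: "poly_over \<rat> [:1:]" by (intro poly_over_const QQ) simp
    have P_eval: "poly P (bcos n k) = (1 + 2 * F k)\<^sup>2 - (2 * G k)\<^sup>2" for k
      by (simp add: P_def F_def G_def power2_eq_square)
    have "F 1 = v" "G 1 = l * y" using V Y by (simp_all add: F_def G_def FP_eval GP_eval l_def)
    hence "poly P (bcos n 1) = poly [:1:] (bcos n 1)"
      unfolding P_eval using pell vy(3,4) by (simp add: power_mult_distrib mult_ac)
    from poly_conjugate_eq[OF n P one this that] show ?thesis by (simp add: P_eval)
  qed
  define Q where "Q = [:1:] + [:2:] * FP + [:2:] * GP"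
  have Q: "poly_over \<rat> (Q * Q)"
  proof -
    have "poly_over \<int> (Q * Q)" unfolding Q_def
      by (intro poly_over_mult poly_over_add poly_over_const ZZ FP GP) auto
    thus ?thesis using Ints_subset_Rats unfolding poly_over_def by blast
  qed
  have Q_eval: "poly Q (bcos n m) = 1 + 2 * F m + 2 * G m" for m
    by (simp add: Q_def F_def G_def)
  have \<epsilon>_eq: "\<epsilon> = poly Q (bcos n 1)"
    unfolding Q_eval using xz(3) vy(3,4) V(2) Y(2) by (simp add: F_def G_def FP_eval GP_eval l_def)
  have "G 1 \<noteq> 0"
  proof
    assume "G 1 = 0"
    hence "\<epsilon> = 1 + 2 * F 1" using \<epsilon>_eq Q_eval by simp
    moreover have "(1 + 2 * F 1)\<^sup>2 = 1" using pell_conj[OF odd_one] \<open>G 1 = 0\<close> by simp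
    ultimately show False using assms(3,4) by (simp add: power2_eq_1_iff)
  qed
  hence "33 * 2 ^ n \<le> (\<Sum>i<2 ^ n. (1 + 2 * F (2 * i + 1) + 2 * G (2 * i + 1))\<^sup>2)"
    using pell_sum_bound[OF assms(1), of d' e' F G] e0 d0 e d pell_conj
    by (simp add: e'_def d'_def)
  also have "\<dots> = field_trace (B_field n) \<rat> (\<epsilon>\<^sup>2)"
    using field_trace_B_field[OF n Q] by (simp add: Q_eval \<epsilon>_eq power2_eq_square)
  finally show ?thesis .
qed

end
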